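(* Let $d\geq 1$, let $C_d=[0,1]^d\subset\mathbb{R}^d$ be the unit hypercube, and let $R_{C_d}$ be its graded algebra over $\mathbb{C}$, bigraded with symmetric weights $(1,\ldots,1)$. For $0\leq k\leq d$ let $[y_k]\in R_{C_d}$ be the element $$[y_k]=\sum_{\substack{\mathbf{v}\in C_d\cap\mathbb{Z}^d\\ \mathbf{v}\cdot(1,\ldots,1)=k}}x_{\mathbf{v},1},$$ which is bihomogeneous of bidegree $(1,k)$. Then $[y_0],\ldots,[y_d]\in R_{C_d}$ form a regular sequence. Moreover, the quotient $$T_{C_d}=R_{C_d}/\langle [y_0],\ldots,[y_d]\rangle$$ is a finite dimensional bigraded $\mathbb{C}$-vector space whose bigraded Hilbert series (in which a homogeneous element of bidegree $(r,k)$ contributes $t^rq^k$) equals the refined Eulerian polynomial $\tilde A_d(t,q)$.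
   Context: For a lattice polytope $\Sigma\subset\mathbb{R}^d$, $R_\Sigma$ is the $\mathbb{C}$-vector space with basis the symbols $x_{\mathbf{v},r}$ for integers $r\geq 0$ and $\mathbf{v}\in r\Sigma\cap\mathbb{Z}^d$ (where $r\Sigma$ is the $r$-fold dilation), made into a commutative $\mathbb{C}$-algebra by $x_{\mathbf{v},r}\cdot x_{\mathbf{v}',r'}=x_{\mathbf{v}+\mathbf{v}',r+r'}$. Given weights $\mathbf{a}\in\mathbb{Z}^d$, it is bigraded by giving $x_{\mathbf{v},r}$ bidegree $(r,\mathbf{v}\cdot\mathbf{a})$; the symmetric bigrading is the case $\mathbf{a}=(1,\ldots,1)$. (In the paper, $y_k$ denotes the same sum in the free polynomial algebra $S_{C_d}=\mathbb{C}[x_{\mathbf{v},1}\mid\mathbf{v}\in C_d\cap\mathbb{Z}^d]$, and $[y_k]$ is its image under the natural surjection $S_{C_d}\to R_{C_d}$.) The refined Eulerian polynomial is $$\tilde A_d(t,q)=\sum_{\sigma\in S_d}q^{\mathrm{maj}(\sigma)}t^{\mathrm{desc}(\sigma)},$$ where here $S_d$ is the symmetric group on $\{1,\ldots,d\}$, a descent position of $\sigma$ is an $i$ with $1\leq i<d$ and $\sigma(i)>\sigma(i+1)$, $\mathrm{desc}(\sigma)$ is the number of descent positions, and the major index $\mathrm{maj}(\sigma)$ is the sum of all the descent positions of $\sigma$. *)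

theory Defs
  imports
    "HOL-Analysis.Analysis"
    "HOL-Library.Poly_Mapping"
    "HOL-Combinatorics.Permutations"
    "HOL-Computational_Algebra.Formal_Laurent_Series"
    "HOL-Algebra.QuotRing"
    "HOL-Algebra.Embedded_Algebras"
begin

section \<open>The algebra of a lattice polytope\<close>

definition dilation_points :: "(real^'d) set \<Rightarrow> nat \<Rightarrow> (int^'d) set" where
  "dilation_points S r = {v. (\<chi> i. real_of_int (v $ i)) \<in> (\<lambda>x. real r *\<^sub>R x) ` S}"

text \<open>
  The monoid algebra of \<open>\<int>\<^sup>d \<times> \<nat>\<close> over the complex numbers is the type
  \<open>((int^'d) \<times> nat) \<Rightarrow>\<^sub>0 complex\<close> with its convolution product. The algebra of a polytope \<open>S\<close>
  is the span in it of the symbols \<open>x_sym v r\<close> with \<open>v\<close> a lattice point of \<open>r S\<close>.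
\<close>

type_synonym 'd lattice_algebra = "((int^'d) \<times> nat) \<Rightarrow>\<^sub>0 complex"

definition x_sym :: "int^'d \<Rightarrow> nat \<Rightarrow> 'd lattice_algebra" where
  "x_sym v r = Poly_Mapping.single (v, r) 1"

definition polytope_ring :: "(real^'d) set \<Rightarrow> 'd lattice_algebra ring" where
  "polytope_ring S =
     \<lparr>carrier = {f. \<forall>(v, r) \<in> Poly_Mapping.keys f. v \<in> dilation_points S r},
      mult = (*), one = 1, zero = 0, add = (+)\<rparr>"

text \<open>The ground field, embedded in the algebra as the constants.\<close>

definition scalars :: "'d::finite lattice_algebra set" where
  "scalars = range (\<lambda>c. Poly_Mapping.single 0 c)"

definition weight :: "int^'d \<Rightarrow> int^'d \<Rightarrow> int" where
  "weight a v = (\<Sum>i\<in>UNIV. v $ i * a $ i)"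

definition bidegree_part :: "(real^'d) set \<Rightarrow> int^'d \<Rightarrow> nat \<times> int \<Rightarrow> 'd lattice_algebra set" where
  "bidegree_part S a p =
     {f \<in> carrier (polytope_ring S).
        \<forall>(v, r) \<in> Poly_Mapping.keys f. (r, weight a v) = p}"

section \<open>Regular sequences\<close>

definition regular_sequence :: "('a, 'b) ring_scheme \<Rightarrow> 'a list \<Rightarrow> bool" where
  "regular_sequence R xs \<longleftrightarrow>
     set xs \<subseteq> carrier R \<and>
     (\<forall>i < length xs.
        let I = genideal R (set (take i xs)); Q = R Quot I in
        \<forall>z \<in> carrier Q. (I +>\<^bsub>R\<^esub> xs ! i) \<otimes>\<^bsub>Q\<^esub> z = \<zero>\<^bsub>Q\<^esub> \<longrightarrow> z = \<zero>\<^bsub>Q\<^esub>) \<and>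
     genideal R (set xs) \<noteq> carrier R"

section \<open>Bigraded vector spaces and Hilbert series\<close>

text \<open>
  Vector spaces are subspaces of a ring \<open>A\<close> containing the ground field \<open>K\<close>; the library's
  predicate \<open>subalgebra K W A\<close> says that \<open>W\<close> is a \<open>K\<close>-linear subspace of \<open>A\<close>
  (not that it is closed under multiplication).
\<close>

definition is_bigrading ::
  "'a set \<Rightarrow> ('a, 'b) ring_scheme \<Rightarrow> (nat \<times> int \<Rightarrow> 'a set) \<Rightarrow> bool" where
  "is_bigrading K A V \<longleftrightarrow>
     (\<forall>p. subalgebra K (V p) A) \<and>
     (\<forall>x \<in> carrier A. \<exists>!c. (\<forall>p. c p \<in> V p) \<and> finite {p. c p \<noteq> \<zero>\<^bsub>A\<^esub>} \<and>
                         x = (\<Oplus>\<^bsub>A\<^esub>p \<in> {p. c p \<noteq> \<zero>\<^bsub>A\<^esub>}. c p))"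

text \<open>
  An element of \<open>\<int>((q))[[t]]\<close>, that is, a power series in \<open>t\<close> over Laurent series in \<open>q\<close>, since weights may be negative. The
  coefficients are meaningful if all parts \<open>V (r, k)\<close> are finite dimensional and, for each \<open>r\<close>,
  vanish for \<open>k\<close> small enough.
\<close>

definition bigraded_hilbert_series ::
  "'a set \<Rightarrow> ('a, 'b) ring_scheme \<Rightarrow> (nat \<times> int \<Rightarrow> 'a set) \<Rightarrow> int fls fps" where
  "bigraded_hilbert_series K A V =
     Abs_fps (\<lambda>r. Abs_fls (\<lambda>k. int (ring.dim A K (V (r, k)))))"

section \<open>The refined Eulerian polynomial\<close>

definition descent_positions :: "nat \<Rightarrow> (nat \<Rightarrow> nat) \<Rightarrow> nat set" where
  "descent_positions d \<sigma> = {i. 1 \<le> i \<and> i < d \<and> \<sigma> i > \<sigma> (i + 1)}"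

definition desc :: "nat \<Rightarrow> (nat \<Rightarrow> nat) \<Rightarrow> nat" where
  "desc d \<sigma> = card (descent_positions d \<sigma>)"

definition maj :: "nat \<Rightarrow> (nat \<Rightarrow> nat) \<Rightarrow> nat" where
  "maj d \<sigma> = \<Sum> (descent_positions d \<sigma>)"

definition refined_eulerian :: "nat \<Rightarrow> 'a::comm_semiring_1 \<Rightarrow> 'a \<Rightarrow> 'a" where
  "refined_eulerian d t q = (\<Sum>\<sigma> | \<sigma> permutes {1..d}. q ^ maj d \<sigma> * t ^ desc d \<sigma>)"

section \<open>The hypercube\<close>

definition hypercube :: "(real^'d) set" where
  "hypercube = {x. \<forall>i. 0 \<le> x $ i \<and> x $ i \<le> 1}"

definition sym_weights :: "int^'d" where
  "sym_weights = (\<chi> i. 1)"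

abbreviation cube_ring :: "'d::finite lattice_algebra ring" where
  "cube_ring \<equiv> polytope_ring hypercube"

definition y_elem :: "nat \<Rightarrow> 'd::finite lattice_algebra" where
  "y_elem k =
     (\<Sum>v | v \<in> dilation_points hypercube 1 \<and> weight sym_weights v = int k. x_sym v 1)"

definition y_list :: "'d::finite lattice_algebra list" where
  "y_list = map y_elem [0..<CARD('d) + 1]"

definition y_ideal :: "'d::finite lattice_algebra set" where
  "y_ideal = genideal cube_ring (set y_list)"

definition cube_quotient :: "'d::finite lattice_algebra set ring" where
  "cube_quotient = cube_ring Quot y_ideal"

definition quotient_scalars :: "'d::finite lattice_algebra set set" where
  "quotient_scalars = (\<lambda>c. y_ideal +>\<^bsub>cube_ring\<^esub> c) ` scalars"

definition quotient_part :: "nat \<times> int \<Rightarrow> 'd::finite lattice_algebra set set" where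
  "quotient_part p =
     (\<lambda>f. y_ideal +>\<^bsub>cube_ring\<^esub> f) ` bidegree_part hypercube sym_weights p"

section \<open>Well-formedness of the definitions\<close>

lemma dilation_points_add:
  assumes "convex S" "v \<in> dilation_points S r" "w \<in> dilation_points S s"
  shows "v + w \<in> dilation_points S (r + s)"
proof -
  obtain x y where x: "x \<in> S" "(\<chi> i. real_of_int (v $ i)) = real r *\<^sub>R x"
    and y: "y \<in> S" "(\<chi> i. real_of_int (w $ i)) = real s *\<^sub>R y"
    using assms(2,3) by (auto simp: dilation_points_def)
  have e: "(\<chi> i. real_of_int ((v + w) $ i)) = real r *\<^sub>R x + real s *\<^sub>R y"
    unfolding x(2)[symmetric] y(2)[symmetric] by (simp add: vec_eq_iff)
  show ?thesis
  proof (cases "r + s = 0")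
    case True
    then show ?thesis using x(1) e by (auto simp: dilation_points_def)
  next
    case False
    define z where "z = (real r / real (r + s)) *\<^sub>R x + (real s / real (r + s)) *\<^sub>R y"
    have "z \<in> S"
      unfolding z_def using False
      by (intro convexD[OF assms(1) x(1) y(1)]) (auto simp: add_divide_distrib[symmetric])
    moreover have "real r *\<^sub>R x + real s *\<^sub>R y = real (r + s) *\<^sub>R z"
      using False unfolding z_def by (simp add: scaleR_add_right del: of_nat_add)
    ultimately show ?thesis using e by (auto simp: dilation_points_def)
  qed
qed

lemma dilation_points_0: "S \<noteq> {} \<Longrightarrow> 0 \<in> dilation_points S 0"
  by (auto simp: dilation_points_def vec_eq_iff)

lemma cring_polytope_ring:
  assumes "convex S" "S \<noteq> {}"
  shows "cring (polytope_ring S)"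
proof (rule cringI)
  show "abelian_group (polytope_ring S)"
  proof (rule abelian_groupI)
    fix f g assume "f \<in> carrier (polytope_ring S)" "g \<in> carrier (polytope_ring S)"
    then show "f \<oplus>\<^bsub>polytope_ring S\<^esub> g \<in> carrier (polytope_ring S)"
      using Poly_Mapping.keys_add[of f g] by (auto simp: polytope_ring_def)
  next
    fix f assume "f \<in> carrier (polytope_ring S)"
    then show "\<exists>g\<in>carrier (polytope_ring S). g \<oplus>\<^bsub>polytope_ring S\<^esub> f = \<zero>\<^bsub>polytope_ring S\<^esub>"
      by (intro bexI[of _ "- f"]) (auto simp: polytope_ring_def)
  qed (auto simp: polytope_ring_def algebra_simps)
  show "Group.comm_monoid (polytope_ring S)"
  proof (rule Group.comm_monoidI)
    fix f g assume fg: "f \<in> carrier (polytope_ring S)" "g \<in> carrier (polytope_ring S)"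
    show "f \<otimes>\<^bsub>polytope_ring S\<^esub> g \<in> carrier (polytope_ring S)"
      using fg Poly_Mapping.keys_mult[of f g] dilation_points_add[OF assms(1)]
      by (fastforce simp: polytope_ring_def)
  next
    show "\<one>\<^bsub>polytope_ring S\<^esub> \<in> carrier (polytope_ring S)"
      using dilation_points_0[OF assms(2)]
      by (auto simp: polytope_ring_def zero_prod_def)
  qed (auto simp: polytope_ring_def algebra_simps)
qed (auto simp: polytope_ring_def algebra_simps)

lemma subfield_scalars:
  assumes "convex S" "S \<noteq> {}"
  shows "subfield scalars (polytope_ring S)"
proof -
  interpret cring "polytope_ring S" by (rule cring_polytope_ring[OF assms])
  note d = polytope_ring_def scalars_def
  have inv: "\<ominus>\<^bsub>polytope_ring S\<^esub> f = - f" if "f \<in> carrier (polytope_ring S)" for f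
    using that by (intro minus_equality) (auto simp: polytope_ring_def)
  have sub: "scalars \<subseteq> carrier (polytope_ring S)"
    using dilation_points_0[OF assms(2)] by (auto simp: d zero_prod_def split: if_splits)
  have "subcring scalars (polytope_ring S)"
  proof (rule subcringI', rule subringI[OF sub])
    show "\<one>\<^bsub>polytope_ring S\<^esub> \<in> scalars"
      by (auto simp: d single_one[symmetric] simp del: single_one)
    show "\<ominus>\<^bsub>polytope_ring S\<^esub> h \<in> scalars" if "h \<in> scalars" for h
      using inv[of h] sub that by (auto simp: scalars_def single_uminus[symmetric] simp del: single_uminus)
    show "h1 \<otimes>\<^bsub>polytope_ring S\<^esub> h2 \<in> scalars" if "h1 \<in> scalars" "h2 \<in> scalars" for h1 h2
      using that by (auto simp: d mult_single)
    show "h1 \<oplus>\<^bsub>polytope_ring S\<^esub> h2 \<in> scalars" if "h1 \<in> scalars" "h2 \<in> scalars" for h1 h2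
      using that by (auto simp: d single_add[symmetric])
  qed
  moreover have "\<exists>k'\<in>scalars. k \<otimes>\<^bsub>polytope_ring S\<^esub> k' = \<one>\<^bsub>polytope_ring S\<^esub>"
    if k: "k \<in> scalars - {\<zero>\<^bsub>polytope_ring S\<^esub>}" for k
  proof -
    obtain c where c: "k = Poly_Mapping.single 0 c" "c \<noteq> 0"
      using k unfolding scalars_def polytope_ring_def by fastforce
    show ?thesis
      using c by (intro bexI[of _ "Poly_Mapping.single 0 (inverse c)"])
        (auto simp: d mult_single single_one[symmetric] simp del: single_one)
  qed
  moreover have "\<one>\<^bsub>polytope_ring S\<^esub> \<noteq> \<zero>\<^bsub>polytope_ring S\<^esub>"
    by (simp add: polytope_ring_def)
  ultimately show ?thesis
  proof (intro subfieldI)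
    assume inv: "\<And>k. k \<in> scalars - {\<zero>\<^bsub>polytope_ring S\<^esub>} \<Longrightarrow>
        \<exists>k'\<in>scalars. k \<otimes>\<^bsub>polytope_ring S\<^esub> k' = \<one>\<^bsub>polytope_ring S\<^esub>"
      and ne: "\<one>\<^bsub>polytope_ring S\<^esub> \<noteq> \<zero>\<^bsub>polytope_ring S\<^esub>"
    show "Units (polytope_ring S\<lparr>carrier := scalars\<rparr>) = scalars - {\<zero>\<^bsub>polytope_ring S\<^esub>}"
    proof (intro equalityI subsetI)
      fix k assume "k \<in> Units (polytope_ring S\<lparr>carrier := scalars\<rparr>)"
      then obtain k' where k: "k \<in> scalars" "k' \<in> scalars"
          "k \<otimes>\<^bsub>polytope_ring S\<^esub> k' = \<one>\<^bsub>polytope_ring S\<^esub>"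
        by (auto simp: Units_def)
      have "k \<noteq> \<zero>\<^bsub>polytope_ring S\<^esub>"
      proof
        assume "k = \<zero>\<^bsub>polytope_ring S\<^esub>"
        moreover have "k' \<in> carrier (polytope_ring S)" using k(2) sub by blast
        ultimately show False using k(3) ne by simp
      qed
      with k(1) show "k \<in> scalars - {\<zero>\<^bsub>polytope_ring S\<^esub>}" by blast
    next
      fix k assume k: "k \<in> scalars - {\<zero>\<^bsub>polytope_ring S\<^esub>}"
      then obtain k' where k': "k' \<in> scalars" "k \<otimes>\<^bsub>polytope_ring S\<^esub> k' = \<one>\<^bsub>polytope_ring S\<^esub>"
        using inv by blast
      have "k \<in> carrier (polytope_ring S)" "k' \<in> carrier (polytope_ring S)"
        using k k'(1) sub by blast+
      then have "k' \<otimes>\<^bsub>polytope_ring S\<^esub> k = \<one>\<^bsub>polytope_ring S\<^esub>"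
        using k'(2) m_comm by simp
      then show "k \<in> Units (polytope_ring S\<lparr>carrier := scalars\<rparr>)"
        using k k' unfolding Units_def by fastforce
    qed
  qed
qed

lemma convex_hypercube: "convex hypercube"
  unfolding hypercube_def by (auto simp: convex_def intro!: convex_bound_le add_nonneg_nonneg)

lemma hypercube_nonempty: "hypercube \<noteq> {}"
  by (auto simp: hypercube_def intro!: exI[of _ 0])

lemma finite_cube_points: "finite (dilation_points hypercube 1 :: (int^'d) set)"
proof (rule finite_subset)
  show "(dilation_points hypercube 1 :: (int^'d) set) \<subseteq> vec_lambda ` (UNIV \<rightarrow>\<^sub>E {0, 1})"
  proof
    fix v :: "int^'d" assume "v \<in> dilation_points hypercube 1"
    then have "\<forall>i. 0 \<le> real_of_int (v $ i) \<and> real_of_int (v $ i) \<le> 1"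
      by (fastforce simp: dilation_points_def hypercube_def vec_eq_iff)
    then have "\<forall>i. v $ i \<in> {0, 1}"
      by (smt (verit) insertCI of_int_0_le_iff of_int_le_1_iff)
    then show "v \<in> vec_lambda ` (UNIV \<rightarrow>\<^sub>E {0, 1})"
      by (intro image_eqI[of _ _ "vec_nth v"]) auto
  qed
qed (intro finite_imageI finite_PiE; simp)

end

theory Submission
  imports Defs
begin

text \<open>
  The element \<open>x_sym v r\<close> behaves like the monomial \<open>s\<^sup>v T\<^sup>r\<close>, so the cube ring has the monomials
  \<open>s\<^sup>v T\<^sup>r\<close> with all \<open>0 \<le> v\<^sub>j \<le> r\<close> as a basis, and \<open>y_elem k\<close> is the elementary symmetric polynomial
  \<open>e\<^sub>k(s) T\<close>. For a permutation \<open>\<sigma>\<close> let \<open>F\<^sub>i\<close> be the set \<open>{\<sigma>(1), \<dots>, \<sigma>(i)}\<close> and let the descent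
  monomial \<open>m\<^sub>\<sigma>\<close> be the product of the \<open>x_sym (ind F\<^sub>i) 1\<close> over the descents \<open>i\<close> of \<open>\<sigma>\<close>; its bidegree
  is \<open>(desc \<sigma>, maj \<sigma>)\<close>. Following Garsia and Stanton, the cube ring is shown to be a free module over
  the polynomial ring in the parameters \<open>y\<^sub>0, \<dots>, y\<^sub>d\<close> with basis the descent monomials; in other
  words, the products \<open>b(\<sigma>, a) = y\<^sup>a m\<^sub>\<sigma>\<close> form a complex basis of it. All parts of the theorem are read
  off from this basis.

  Why it is a basis: expand \<open>b(\<sigma>, a)\<close> into monomials. Every monomial of the expansion arises by
  choosing for each factor \<open>y\<^sub>i\<close> some set \<open>G\<close> of size \<open>i\<close>, the sets of the descent monomial being
  prescribed. One of the choices is to take \<open>F\<^sub>i\<close> throughout, and the resulting monomial is the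
  leading one for the following order. First compare the sum of the squares of the exponents:
  it is a sum of cardinalities of pairwise intersections, hence largest exactly when the chosen
  sets form a chain. Among chains, compare a linear form with decreasing weights: a set \<open>G\<close>
  that is nested with \<open>F\<^sub>j\<close> for every descent \<open>j\<close> differs from \<open>F\<^sub>i\<close> only inside a block on which
  \<open>\<sigma>\<close> increases, so \<open>F\<^sub>i\<close> consists of the smallest possible elements
  (\<open>sum_image_initial_less\<close>, \<open>potential_choice_less\<close>). The leading monomial determines \<open>(\<sigma>, a)\<close>, and
  every monomial leads some \<open>b(\<sigma>, a)\<close>: sort the exponents in decreasing order, breaking ties by
  increasing position. The sorting permutation is \<open>\<sigma>\<close>, and \<open>a\<close> records by how much the successive
  drops exceed the unit drop forced at a descent (\<open>bij_lead_monomial\<close>). So the family is unitriangular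
  with respect to the monomial basis, within each bidegree as well.

  Multiplication by \<open>y\<^sub>k\<close> sends \<open>b(\<sigma>, a)\<close> to \<open>b(\<sigma>, a + \<delta>\<^sub>k)\<close>. Hence the ideal of
  \<open>y\<^sub>0, \<dots>, y\<^bsub>k-1\<^esub>\<close> is spanned by the basis elements with \<open>a\<^sub>i > 0\<close> for some \<open>i < k\<close>
  (\<open>genideal_y_elem\<close>), and \<open>y\<^sub>k\<close> is not a zero divisor modulo it. The quotient by all parameters has
  the classes of the descent monomials as a basis, and counting them by bidegree gives the
  refined Eulerian polynomial.
\<close>

(* From here on the infix dollar is vector indexing, not a coefficient of a power series. *)
unbundle no fps_syntax

section \<open>Chains cut out by a permutation\<close>

lemma no_descent_imp_less:
  assumes \<sigma>: "\<sigma> permutes {1..d}" and "1 \<le> s" "s < t" "t \<le> d"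
    and nodesc: "\<And>j. s \<le> j \<Longrightarrow> j < t \<Longrightarrow> j \<notin> descent_positions d \<sigma>"
  shows "\<sigma> s < \<sigma> t"
proof -
  have step: "\<sigma> j < \<sigma> (Suc j)" if "s \<le> j" "j < t" for j
  proof -
    have "\<not> \<sigma> j > \<sigma> (Suc j)"
      using nodesc[OF that] that assms by (auto simp: descent_positions_def)
    moreover have "\<sigma> j \<noteq> \<sigma> (Suc j)"
      using permutes_inj[OF \<sigma>] by (metis injD n_not_Suc_n)
    ultimately show ?thesis by simp
  qed
  have "Suc s \<le> t" using \<open>s < t\<close> by simp
  then show ?thesis
    using step
  proof (induction t rule: dec_induct)
    case base
    then show ?case by simp
  next
    case (step n)
    then have "\<sigma> s < \<sigma> n" "\<sigma> n < \<sigma> (Suc n)" by auto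
    then show ?case by simp
  qed
qed

text \<open>
  An element \<open>\<sigma> s\<close> of \<open>\<sigma> ` {1..card G}\<close> missing from \<open>G\<close> and an element \<open>\<sigma> t\<close> of \<open>G\<close> outside that image
  satisfy \<open>s < t\<close>, and nestedness leaves no descent in between; so \<open>\<sigma> s < \<sigma> t\<close>, and replacing the
  former elements by the equally many latter ones increases the sum.
\<close>

lemma sum_image_initial_less:
  fixes G :: "nat set"
  assumes \<sigma>: "\<sigma> permutes {1..d}" and G: "G \<subseteq> {1..d}"
    and below: "\<And>j. j \<in> descent_positions d \<sigma> \<Longrightarrow> j \<le> card G \<Longrightarrow> \<sigma> ` {1..j} \<subseteq> G"
    and above: "\<And>j. j \<in> descent_positions d \<sigma> \<Longrightarrow> card G \<le> j \<Longrightarrow> G \<subseteq> \<sigma> ` {1..j}"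
    and ne: "G \<noteq> \<sigma> ` {1..card G}"
  shows "\<Sum> (\<sigma> ` {1..card G}) < \<Sum> G"
proof -
  define i where "i = card G"
  define F where "F = \<sigma> ` {1..i}"
  have inj: "inj \<sigma>" using permutes_inj[OF \<sigma>] .
  have fG: "finite G" using G finite_subset by blast
  have id: "i \<le> d" using card_mono[OF _ G] by (simp add: i_def)
  have cF: "card F = i" and fF: "finite F"
    unfolding F_def by (simp_all add: card_image inj_on_subset[OF inj])
  have cAB: "card (F - G) = card (G - F)"
    using card_Diff_subset_Int[of F G] card_Diff_subset_Int[of G F] cF fF fG
    by (simp add: i_def Int_commute)
  have neA: "F - G \<noteq> {}"
  proof
    assume "F - G = {}"
    then have "F \<subseteq> G" by blast
    with card_subset_eq[OF fG this] cF ne show False by (simp add: i_def F_def)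
  qed
  have less: "a < b" if a: "a \<in> F - G" and b: "b \<in> G - F" for a b
  proof -
    obtain s where s: "a = \<sigma> s" "1 \<le> s" "s \<le> i" using a by (auto simp: F_def)
    obtain t where t: "b = \<sigma> t" "t \<in> {1..d}"
      using b G permutes_image[OF \<sigma>] by (metis DiffD1 imageE subsetD)
    have "i < t" using b t by (auto simp: F_def not_le[symmetric])
    have "j \<notin> descent_positions d \<sigma>" if "s \<le> j" "j < t" for j
    proof
      assume D: "j \<in> descent_positions d \<sigma>"
      show False
      proof (cases "j \<le> i")
        case True
        then have "a \<in> G" using below[OF D] s that by (auto simp: i_def)
        then show False using a by simp
      next
        case False
        then have "b \<in> \<sigma> ` {1..j}" using above[OF D] b by (auto simp: i_def)
        then show False using t that inj_eq[OF inj] by auto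
      qed
    qed
    then show ?thesis
      using no_descent_imp_less[OF \<sigma>, of s t] s t \<open>i < t\<close> by auto
  qed
  \<comment> \<open>Both differences have the same size, and \<open>m\<close> separates them.\<close>
  define m where "m = Max (F - G)"
  have "\<Sum> (F - G) \<le> (\<Sum>x\<in>F - G. m)"
    unfolding m_def by (intro sum_mono Max_ge) (use fF in auto)
  also have "\<dots> < (\<Sum>x\<in>F - G. Suc m)"
    using neA fF by (intro sum_strict_mono) auto
  also have "\<dots> = (\<Sum>x\<in>G - F. Suc m)" by (simp add: cAB)
  also have "\<dots> \<le> \<Sum> (G - F)"
  proof (intro sum_mono)
    fix b assume b: "b \<in> G - F"
    have "m \<in> F - G" unfolding m_def using neA fF by (intro Max_in) auto
    from less[OF this b] show "Suc m \<le> b" by simp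
  qed
  finally have "\<Sum> (F - G) + \<Sum> (F \<inter> G) < \<Sum> (G - F) + \<Sum> (G \<inter> F)"
    by (simp add: Int_commute)
  then show ?thesis
    using sum.Int_Diff[OF fF, of "\<lambda>x. x" G] sum.Int_Diff[OF fG, of "\<lambda>x. x" F]
    by (simp add: F_def i_def add.commute)
qed

lemma card_image_initial: "\<sigma> permutes S \<Longrightarrow> card (\<sigma> ` {1..i}) = i"
  by (simp add: card_image inj_on_subset[OF permutes_inj])

lemma image_initial_subset:
  fixes \<sigma> :: "nat \<Rightarrow> nat"
  assumes "\<sigma> permutes {1..d}" "i \<le> d"
  shows "\<sigma> ` {1..i} \<subseteq> {1..d}"
proof -
  have "\<sigma> ` {1..i} \<subseteq> \<sigma> ` {1..d}" using assms(2) by (intro image_mono) auto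
  then show ?thesis using permutes_image[OF assms(1)] by simp
qed

section \<open>Indicator vectors and their potential\<close>

text \<open>
  The coordinates are indexed by an unordered finite type, while descents refer to the order of
  \<open>{1..d}\<close>; an arbitrary numbering mediates between the two.
\<close>

definition idx :: "'d::finite \<Rightarrow> nat" where
  "idx = (SOME h. bij_betw h UNIV {1..CARD('d)})"

lemma bij_idx: "bij_betw (idx :: 'd::finite \<Rightarrow> nat) UNIV {1..CARD('d)}"
proof -
  have "\<exists>h :: 'd \<Rightarrow> nat. bij_betw h UNIV {1..CARD('d)}"
    by (intro finite_same_card_bij) auto
  then show ?thesis unfolding idx_def by (rule someI_ex)
qed

lemma idx_in: "idx (x :: 'd::finite) \<in> {1..CARD('d)}"
  using bij_idx bij_betwE by blast

lemma sum_idx: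
  "(\<Sum>x\<in>(UNIV :: 'd::finite set). h (idx x)) = (\<Sum>j\<in>{1..CARD('d)}. h j)"
  by (rule sum.reindex_bij_betw[OF bij_idx])

lemma sum_idx_mem:
  fixes h :: "nat \<Rightarrow> 'b::comm_semiring_1"
  assumes "G \<subseteq> {1..CARD('d::finite)}"
  shows "(\<Sum>x\<in>(UNIV :: 'd set). h (idx x) * of_bool (idx x \<in> G)) = (\<Sum>j\<in>G. h j)"
proof -
  have "(\<Sum>x\<in>(UNIV :: 'd set). h (idx x) * of_bool (idx x \<in> G))
      = (\<Sum>j\<in>{1..CARD('d)}. h j * of_bool (j \<in> G))"
    by (rule sum_idx)
  also have "\<dots> = (\<Sum>j\<in>G. h j)"
    by (rule sum.mono_neutral_cong_right) (use assms in auto)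
  finally show ?thesis .
qed

definition ind :: "nat set \<Rightarrow> int^'d::finite" where
  "ind G = (\<chi> x. of_bool (idx x \<in> G))"

text \<open>
  A single natural number that compares vectors first by the sum of the squares of the entries and
  then by a linear form with weights decreasing along the numbering: on sums of \<open>r\<close> indicator
  vectors the linear form is at most \<open>r d\<^sup>2\<close>, hence the factor \<open>r d\<^sup>2 + 1\<close>.
\<close>

definition potential :: "(int^'d::finite) \<times> nat \<Rightarrow> nat" where
  "potential = (\<lambda>(u, r). nat ((\<Sum>x\<in>UNIV. (u $ x)\<^sup>2) * (int r * int CARD('d) * int CARD('d) + 1)
      + (\<Sum>x\<in>UNIV. int (CARD('d) - idx x) * u $ x)))"

lemma sum_squares_indicators:
  fixes g :: "'a \<Rightarrow> nat set"
  assumes "\<And>\<alpha>. \<alpha> \<in> I \<Longrightarrow> g \<alpha> \<subseteq> {1..CARD('d::finite)}"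
  shows "(\<Sum>x\<in>UNIV. ((\<Sum>\<alpha>\<in>I. ind (g \<alpha>) :: int^'d) $ x)\<^sup>2)
    = (\<Sum>\<alpha>\<in>I. \<Sum>\<beta>\<in>I. int (card (g \<alpha> \<inter> g \<beta>)))"
proof -
  have "(\<Sum>x\<in>UNIV. ((\<Sum>\<alpha>\<in>I. ind (g \<alpha>) :: int^'d) $ x)\<^sup>2)
     = (\<Sum>x\<in>(UNIV::'d set). \<Sum>\<alpha>\<in>I. \<Sum>\<beta>\<in>I. 1 * of_bool (idx x \<in> g \<alpha> \<inter> g \<beta>))"
    by (intro sum.cong) (auto simp: ind_def power2_eq_square sum_product intro!: sum.cong)
  also have "\<dots> = (\<Sum>\<alpha>\<in>I. \<Sum>\<beta>\<in>I. \<Sum>x\<in>(UNIV::'d set). 1 * of_bool (idx x \<in> g \<alpha> \<inter> g \<beta>))"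
    by (subst sum.swap, intro sum.cong refl, subst sum.swap) simp
  also have "\<dots> = (\<Sum>\<alpha>\<in>I. \<Sum>\<beta>\<in>I. int (card (g \<alpha> \<inter> g \<beta>)))"
  proof (intro sum.cong refl)
    fix \<alpha> \<beta> assume "\<alpha> \<in> I" "\<beta> \<in> I"
    then have "g \<alpha> \<inter> g \<beta> \<subseteq> {1..CARD('d)}" using assms by blast
    from sum_idx_mem[OF this, of "\<lambda>_. 1 :: int"]
    show "(\<Sum>x\<in>(UNIV::'d set). 1 * of_bool (idx x \<in> g \<alpha> \<inter> g \<beta>)) = int (card (g \<alpha> \<inter> g \<beta>))"
      by simp
  qed
  finally show ?thesis .
qed

lemma linear_indicators:
  fixes g :: "'a \<Rightarrow> nat set" and h :: "nat \<Rightarrow> int"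
  assumes "\<And>\<alpha>. \<alpha> \<in> I \<Longrightarrow> g \<alpha> \<subseteq> {1..CARD('d::finite)}"
  shows "(\<Sum>x\<in>UNIV. h (idx x) * (\<Sum>\<alpha>\<in>I. ind (g \<alpha>) :: int^'d) $ x) = (\<Sum>\<alpha>\<in>I. \<Sum>j\<in>g \<alpha>. h j)"
proof -
  have "(\<Sum>x\<in>UNIV. h (idx x) * (\<Sum>\<alpha>\<in>I. ind (g \<alpha>) :: int^'d) $ x)
     = (\<Sum>x\<in>(UNIV::'d set). \<Sum>\<alpha>\<in>I. h (idx x) * of_bool (idx x \<in> g \<alpha>))"
    by (simp add: ind_def sum_distrib_left)
  also have "\<dots> = (\<Sum>\<alpha>\<in>I. \<Sum>x\<in>(UNIV::'d set). h (idx x) * of_bool (idx x \<in> g \<alpha>))"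
    by (rule sum.swap)
  also have "\<dots> = (\<Sum>\<alpha>\<in>I. \<Sum>j\<in>g \<alpha>. h j)"
    by (intro sum.cong refl sum_idx_mem assms)
  finally show ?thesis .
qed

lemma weight_indicators:
  fixes g :: "'a \<Rightarrow> nat set"
  assumes "\<And>\<alpha>. \<alpha> \<in> I \<Longrightarrow> g \<alpha> \<subseteq> {1..CARD('d::finite)}"
  shows "weight sym_weights (\<Sum>\<alpha>\<in>I. ind (g \<alpha>) :: int^'d) = (\<Sum>\<alpha>\<in>I. int (card (g \<alpha>)))"
  using linear_indicators[where h = "\<lambda>_. 1" and g = g and I = I, OF assms] by (simp add: weight_def sym_weights_def)

text \<open>
  The combinatorial heart of the triangularity. A family \<open>f\<close> forming a chain maximises the sum of the
  squares among all families with the same cardinalities, because \<open>card (g \<alpha> \<inter> g \<beta>)\<close> is at most the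
  smaller of the two cardinalities. If \<open>g\<close> attains this maximum, all intersections are as large as
  possible, so \<open>g\<close> is a chain too, and the linear form decides by the hypothesis on nested families.
\<close>

lemma potential_indicators_less:
  fixes f g :: "'a \<Rightarrow> nat set"
  assumes I: "finite I"
    and f: "\<And>\<alpha>. \<alpha> \<in> I \<Longrightarrow> f \<alpha> \<subseteq> {1..CARD('d::finite)}"
    and g: "\<And>\<alpha>. \<alpha> \<in> I \<Longrightarrow> g \<alpha> \<subseteq> {1..CARD('d)}"
    and card: "\<And>\<alpha>. \<alpha> \<in> I \<Longrightarrow> card (g \<alpha>) = card (f \<alpha>)"
    and chain: "\<And>\<alpha> \<beta>. \<alpha> \<in> I \<Longrightarrow> \<beta> \<in> I \<Longrightarrow> f \<alpha> \<subseteq> f \<beta> \<or> f \<beta> \<subseteq> f \<alpha>"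
    and least: "\<And>\<alpha>. \<alpha> \<in> I \<Longrightarrow> g \<alpha> \<noteq> f \<alpha> \<Longrightarrow>
      (\<And>\<beta> \<gamma>. \<beta> \<in> I \<Longrightarrow> \<gamma> \<in> I \<Longrightarrow> card (g \<beta>) \<le> card (g \<gamma>) \<Longrightarrow> g \<beta> \<subseteq> g \<gamma>) \<Longrightarrow>
      \<Sum> (f \<alpha>) < \<Sum> (g \<alpha>)"
    and ne: "\<exists>\<alpha>\<in>I. g \<alpha> \<noteq> f \<alpha>"
  shows "potential (\<Sum>\<alpha>\<in>I. ind (g \<alpha>) :: int^'d, card I) < potential (\<Sum>\<alpha>\<in>I. ind (f \<alpha>) :: int^'d, card I)"
proof -
  define d where "d = CARD('d)"
  define Q :: "int^'d \<Rightarrow> int" where "Q u = (\<Sum>x\<in>UNIV. (u $ x)\<^sup>2)" for u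
  define l :: "int^'d \<Rightarrow> int" where "l u = (\<Sum>x\<in>UNIV. int (d - idx x) * u $ x)" for u
  define N where "N = int (card I) * int d * int d + 1"
  define u v where "u = (\<Sum>\<alpha>\<in>I. ind (g \<alpha>) :: int^'d)" and "v = (\<Sum>\<alpha>\<in>I. ind (f \<alpha>) :: int^'d)"
  have pot: "potential (w, card I) = nat (Q w * N + l w)" for w :: "int^'d"
    by (simp add: potential_def Q_def l_def N_def d_def)
  have fin: "finite (g \<alpha>)" "finite (f \<alpha>)" if "\<alpha> \<in> I" for \<alpha>
    using finite_subset[OF g[OF that]] finite_subset[OF f[OF that]] by simp_all
  have Qu: "Q u = (\<Sum>\<alpha>\<in>I. \<Sum>\<beta>\<in>I. int (card (g \<alpha> \<inter> g \<beta>)))"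
    unfolding Q_def u_def using g by (rule sum_squares_indicators)
  have Qv: "Q v = (\<Sum>\<alpha>\<in>I. \<Sum>\<beta>\<in>I. int (card (f \<alpha> \<inter> f \<beta>)))"
    unfolding Q_def v_def using f by (rule sum_squares_indicators)
  have lu: "l u = (\<Sum>\<alpha>\<in>I. \<Sum>j\<in>g \<alpha>. int (d - j))"
    unfolding l_def u_def using g by (rule linear_indicators)
  have lv: "l v = (\<Sum>\<alpha>\<in>I. \<Sum>j\<in>f \<alpha>. int (d - j))"
    unfolding l_def v_def using f by (rule linear_indicators)
  have lG: "(\<Sum>j\<in>G. int (d - j)) = int d * int (card G) - int (\<Sum>G)" if "G \<subseteq> {1..d}" for G
  proof -
    have "(\<Sum>j\<in>G. int (d - j)) = (\<Sum>j\<in>G. int d - int j)"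
      by (intro sum.cong) (use that in auto)
    then show ?thesis by (simp add: sum_subtractf)
  qed
  have cap: "int (card (g \<alpha> \<inter> g \<beta>)) \<le> int (card (f \<alpha> \<inter> f \<beta>))" if "\<alpha> \<in> I" "\<beta> \<in> I" for \<alpha> \<beta>
  proof -
    have "card (g \<alpha> \<inter> g \<beta>) \<le> card (g \<alpha>)" "card (g \<alpha> \<inter> g \<beta>) \<le> card (g \<beta>)"
      using fin that by (auto intro: card_mono)
    moreover have "f \<alpha> \<inter> f \<beta> = f \<alpha> \<or> f \<alpha> \<inter> f \<beta> = f \<beta>"
      using chain[OF that] by blast
    ultimately show ?thesis using card that by (metis of_nat_mono)
  qed
  have Qle: "Q u \<le> Q v" unfolding Qu Qv by (intro sum_mono cap)
  have lu0: "0 \<le> l u" unfolding lu by (intro sum_nonneg) auto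
  have lv0: "0 \<le> l v" unfolding lv by (intro sum_nonneg) auto
  have N0: "N > 0" by (simp add: N_def add_nonneg_pos)
  have Qu0: "0 \<le> Q u" unfolding Qu by (intro sum_nonneg) auto
  have "l u \<le> (\<Sum>\<alpha>\<in>I. int d * int d)"
    unfolding lu
  proof (rule sum_mono)
    fix \<alpha> assume \<alpha>: "\<alpha> \<in> I"
    have "int (card (g \<alpha>)) \<le> int d" using card_mono[OF _ g[OF \<alpha>]] by (simp add: d_def)
    then have "int (card (g \<alpha>)) * int d \<le> int d * int d" by (intro mult_right_mono) auto
    moreover have "(\<Sum>j\<in>g \<alpha>. int (d - j)) \<le> (\<Sum>j\<in>g \<alpha>. int d)" by (intro sum_mono) auto
    ultimately show "(\<Sum>j\<in>g \<alpha>. int (d - j)) \<le> int d * int d" by simp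
  qed
  then have luN: "l u < N" by (simp add: N_def mult.assoc)
  have "Q u * N + l u < Q v * N + l v"
  proof (cases "Q u < Q v")
    case True
    then have "(Q u + 1) * N \<le> Q v * N" using N0 by (intro mult_right_mono) auto
    then show ?thesis using luN lv0 by (simp add: algebra_simps)
  next
    case False
    then have eq: "Q u = Q v" using Qle by simp
    have inner: "(\<Sum>\<beta>\<in>I. int (card (g \<alpha> \<inter> g \<beta>))) = (\<Sum>\<beta>\<in>I. int (card (f \<alpha> \<inter> f \<beta>)))"
      if "\<alpha> \<in> I" for \<alpha>
    proof (rule ccontr)
      assume "\<not> ?thesis"
      then have "(\<Sum>\<beta>\<in>I. int (card (g \<alpha> \<inter> g \<beta>))) < (\<Sum>\<beta>\<in>I. int (card (f \<alpha> \<inter> f \<beta>)))"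
        using sum_mono[of I "\<lambda>\<beta>. int (card (g \<alpha> \<inter> g \<beta>))" "\<lambda>\<beta>. int (card (f \<alpha> \<inter> f \<beta>))"] cap that
        by fastforce
      then have "Q u < Q v" unfolding Qu Qv
        using I that by (intro sum_strict_mono_ex1) (auto intro!: sum_mono cap)
      then show False using eq by simp
    qed
    have capeq: "card (g \<alpha> \<inter> g \<beta>) = card (f \<alpha> \<inter> f \<beta>)" if "\<alpha> \<in> I" "\<beta> \<in> I" for \<alpha> \<beta>
    proof (rule ccontr)
      assume "\<not> ?thesis"
      then have "int (card (g \<alpha> \<inter> g \<beta>)) < int (card (f \<alpha> \<inter> f \<beta>))" using cap[OF that] by simp
      then have "(\<Sum>\<beta>\<in>I. int (card (g \<alpha> \<inter> g \<beta>))) < (\<Sum>\<beta>\<in>I. int (card (f \<alpha> \<inter> f \<beta>)))"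
        using I that cap by (intro sum_strict_mono_ex1) auto
      then show False using inner[OF that(1)] by simp
    qed
    have nested: "g \<alpha> \<subseteq> g \<beta>" if "\<alpha> \<in> I" "\<beta> \<in> I" "card (g \<alpha>) \<le> card (g \<beta>)" for \<alpha> \<beta>
    proof -
      have "f \<alpha> \<inter> f \<beta> = f \<alpha> \<or> f \<beta> \<subseteq> f \<alpha> \<and> f \<alpha> \<inter> f \<beta> = f \<beta>" using chain[OF that(1,2)] by blast
      then have "card (f \<alpha> \<inter> f \<beta>) = card (f \<alpha>)"
        using that card card_mono[of "f \<alpha>" "f \<beta>"] fin by auto
      then have "card (g \<alpha> \<inter> g \<beta>) = card (g \<alpha>)" using capeq that card by simp
      then have "g \<alpha> \<inter> g \<beta> = g \<alpha>" using fin that by (intro card_subset_eq) auto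
      then show ?thesis by blast
    qed
    have linear_less: "(\<Sum>j\<in>g \<alpha>. int (d - j)) < (\<Sum>j\<in>f \<alpha>. int (d - j))" if "\<alpha> \<in> I" "g \<alpha> \<noteq> f \<alpha>" for \<alpha>
    proof -
      have "int (\<Sum> (f \<alpha>)) < int (\<Sum> (g \<alpha>))"
        unfolding of_nat_less_iff by (rule least[OF that]) (rule nested)
      then show ?thesis
        using lG[OF f[OF that(1), folded d_def]] lG[OF g[OF that(1), folded d_def]] card[OF that(1)]
        by (simp del: of_nat_sum)
    qed
    have "l u < l v" unfolding lu lv
    proof (rule sum_strict_mono_ex1[OF I])
      show "\<forall>\<alpha>\<in>I. (\<Sum>j\<in>g \<alpha>. int (d - j)) \<le> (\<Sum>j\<in>f \<alpha>. int (d - j))"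
        using linear_less by (metis less_imp_le order_refl)
      show "\<exists>\<alpha>\<in>I. (\<Sum>j\<in>g \<alpha>. int (d - j)) < (\<Sum>j\<in>f \<alpha>. int (d - j))"
        using linear_less ne by blast
    qed
    then show ?thesis using eq by simp
  qed
  moreover have "0 \<le> Q u * N + l u" using Qu0 N0 lu0 by simp
  ultimately show ?thesis by (simp add: pot u_def[symmetric] v_def[symmetric])
qed

section \<open>Unitriangular families in a monoid algebra\<close>

lemma lookup_single_zero_mult:
  fixes f :: "'k::comm_monoid_add \<Rightarrow>\<^sub>0 'c::field"
  shows "Poly_Mapping.lookup (Poly_Mapping.single 0 c * f) m = c * Poly_Mapping.lookup f m"
  by (simp add: mult_map_scale_conv_mult[symmetric] Poly_Mapping.map.rep_eq when_def)

text \<open>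
  The constants act by multiplication with \<open>Poly_Mapping.single 0 c\<close>; as a vector space for this action,
  the monoid algebra has spans, independent sets and coordinate functions.
\<close>

interpretation monoid_algebra: vector_space
  "\<lambda>(c :: 'c::field) (f :: 'k::comm_monoid_add \<Rightarrow>\<^sub>0 'c). Poly_Mapping.single 0 c * f"
  by unfold_locales
    (simp_all add: algebra_simps single_add mult_single mult.assoc[symmetric])

lemma mem_span_if_monomials:
  fixes f :: "'k::comm_monoid_add \<Rightarrow>\<^sub>0 'c::field"
  assumes "\<And>m. m \<in> Poly_Mapping.keys f \<Longrightarrow> Poly_Mapping.single m 1 \<in> monoid_algebra.span S"
  shows "f \<in> monoid_algebra.span S"
proof -
  have "f = (\<Sum>m\<in>Poly_Mapping.keys f. Poly_Mapping.single 0 (Poly_Mapping.lookup f m) * Poly_Mapping.single m 1)"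
    by (rule poly_mapping_eqI)
      (auto simp: lookup_sum mult_single lookup_single when_def in_keys_iff)
  also have "\<dots> \<in> monoid_algebra.span S"
    by (intro monoid_algebra.span_sum monoid_algebra.span_scale assms)
  finally show ?thesis .
qed

lemma subspace_keys:
  "monoid_algebra.subspace {f :: 'k::comm_monoid_add \<Rightarrow>\<^sub>0 'c::field. Poly_Mapping.keys f \<subseteq> M}"
proof (intro monoid_algebra.subspaceI)
  show "f + g \<in> {f. Poly_Mapping.keys f \<subseteq> M}"
    if "f \<in> {f. Poly_Mapping.keys f \<subseteq> M}" "g \<in> {f. Poly_Mapping.keys f \<subseteq> M}"
    for f g :: "'k \<Rightarrow>\<^sub>0 'c"
    using that Poly_Mapping.keys_add[of f g] by blast
  show "Poly_Mapping.single 0 c * f \<in> {f. Poly_Mapping.keys f \<subseteq> M}"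
    if "f \<in> {f. Poly_Mapping.keys f \<subseteq> M}" for c and f :: "'k \<Rightarrow>\<^sub>0 'c"
    using that by (auto simp: in_keys_iff lookup_single_zero_mult)
qed simp

text \<open>
  The terms of a member \<open>b j\<close> other than \<open>lead j\<close> are smaller for \<open>\<Phi>\<close>, and the leading monomials match the
  members with the monomials in \<open>M\<close>. Such a family is a basis of the elements supported on \<open>M\<close>.
\<close>

locale unitriangular =
  fixes b :: "'j \<Rightarrow> 'k::comm_monoid_add \<Rightarrow>\<^sub>0 'c::field"
    and lead :: "'j \<Rightarrow> 'k" and J M and \<Phi> :: "'k \<Rightarrow> nat"
  assumes bij: "bij_betw lead J M"
    and lookup_lead: "j \<in> J \<Longrightarrow> Poly_Mapping.lookup (b j) (lead j) = 1"
    and keys_subset: "j \<in> J \<Longrightarrow> Poly_Mapping.keys (b j) \<subseteq> M"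
    and smaller: "j \<in> J \<Longrightarrow> m \<in> Poly_Mapping.keys (b j) \<Longrightarrow> m \<noteq> lead j \<Longrightarrow> \<Phi> m < \<Phi> (lead j)"
begin

lemma inj_on_family: "inj_on b J"
proof (rule inj_onI, rule ccontr)
  fix i j assume ij: "i \<in> J" "j \<in> J" "b i = b j" "i \<noteq> j"
  then have ne: "lead i \<noteq> lead j" using bij by (auto simp: bij_betw_def inj_on_def)
  have "lead i \<in> Poly_Mapping.keys (b j)" "lead j \<in> Poly_Mapping.keys (b i)"
    using ij lookup_lead by (metis in_keys_iff one_neq_zero)+
  then show False using smaller ij ne by (metis less_asym)
qed

text \<open>
  By induction on \<open>\<Phi> m\<close> each monomial \<open>m\<close> of \<open>M\<close> lies in the span: subtract from the family member led by
  \<open>m\<close> its lower terms.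
\<close>

lemma span_eq: "monoid_algebra.span (b ` J) = {f. Poly_Mapping.keys f \<subseteq> M}"
proof
  show "monoid_algebra.span (b ` J) \<subseteq> {f. Poly_Mapping.keys f \<subseteq> M}"
    using keys_subset by (intro monoid_algebra.span_minimal subspace_keys) auto
  have mono: "Poly_Mapping.single m 1 \<in> monoid_algebra.span (b ` J)" if "m \<in> M" for m
    using that
  proof (induction m rule: measure_induct_rule[of \<Phi>])
    case (less m)
    then obtain j where j: "j \<in> J" "lead j = m" using bij by (auto simp: bij_betw_def)
    define h where "h = b j - Poly_Mapping.single m 1"
    have "h \<in> monoid_algebra.span (b ` J)"
    proof (rule mem_span_if_monomials)
      fix m' assume m': "m' \<in> Poly_Mapping.keys h"
      then have "m' \<noteq> m"
        using lookup_lead[OF j(1)] j by (auto simp: h_def in_keys_iff lookup_minus)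
      then have "m' \<in> Poly_Mapping.keys (b j)"
        using m' by (auto simp: h_def in_keys_iff lookup_minus lookup_single)
      then show "Poly_Mapping.single m' 1 \<in> monoid_algebra.span (b ` J)"
        using less.IH smaller[OF j(1)] keys_subset[OF j(1)] j \<open>m' \<noteq> m\<close> by blast
    qed
    moreover have "b j \<in> monoid_algebra.span (b ` J)"
      using j by (intro monoid_algebra.span_base) auto
    ultimately have "b j - h \<in> monoid_algebra.span (b ` J)" by (rule monoid_algebra.span_diff[rotated])
    then show ?case by (simp add: h_def)
  qed
  show "{f. Poly_Mapping.keys f \<subseteq> M} \<subseteq> monoid_algebra.span (b ` J)"
  proof
    fix f :: "'k \<Rightarrow>\<^sub>0 'c" assume "f \<in> {f. Poly_Mapping.keys f \<subseteq> M}"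
    then have f: "m \<in> M" if "m \<in> Poly_Mapping.keys f" for m using that by blast
    show "f \<in> monoid_algebra.span (b ` J)"
      by (rule mem_span_if_monomials) (rule mono[OF f])
  qed
qed

text \<open>
  In a linear relation, look at a member \<open>b j\<close> with nonzero coefficient and \<open>\<Phi> (lead j)\<close> maximal: no other
  member of the relation can contain the monomial \<open>lead j\<close>.
\<close>

lemma independent_family: "monoid_algebra.independent (b ` J)"
proof
  assume "monoid_algebra.dependent (b ` J)"
  then obtain t u where t: "finite t" "t \<subseteq> b ` J"
    and zero: "(\<Sum>v\<in>t. Poly_Mapping.single 0 (u v) * v) = 0" and ex: "\<exists>v\<in>t. u v \<noteq> 0"
    unfolding monoid_algebra.dependent_explicit by blast
  define T where "T = {j \<in> J. b j \<in> t \<and> u (b j) \<noteq> 0}"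
  have "finite T"
    using t inj_on_family
    by (intro finite_vimage_IntI[of t b J, THEN finite_subset[rotated]]) (auto simp: T_def)
  moreover have "T \<noteq> {}" using ex t by (auto simp: T_def)
  ultimately have "Max (\<Phi> ` lead ` T) \<in> \<Phi> ` lead ` T" by (intro Max_in) auto
  then obtain j where j: "j \<in> T" and max: "\<Phi> (lead j) = Max (\<Phi> ` lead ` T)" by auto
  have le: "\<Phi> (lead i) \<le> \<Phi> (lead j)" if "i \<in> T" for i
    unfolding max using that \<open>finite T\<close> by (intro Max_ge) auto
  have jJ: "j \<in> J" "b j \<in> t" "u (b j) \<noteq> 0" using j by (auto simp: T_def)
  have vanish: "u v * Poly_Mapping.lookup v (lead j) = 0" if v: "v \<in> t - {b j}" for v
  proof (rule ccontr)
    assume ne: "u v * Poly_Mapping.lookup v (lead j) \<noteq> 0"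
    obtain i where i: "i \<in> J" "v = b i" using v t by auto
    have "i \<in> T" using ne i v by (auto simp: T_def)
    have "lead j \<noteq> lead i" using i jJ v bij by (auto simp: bij_betw_def inj_on_def)
    moreover have "lead j \<in> Poly_Mapping.keys (b i)" using ne i by (auto simp: in_keys_iff)
    ultimately have "\<Phi> (lead j) < \<Phi> (lead i)" using smaller i by blast
    then show False using le[OF \<open>i \<in> T\<close>] by simp
  qed
  have rest: "(\<Sum>v\<in>t - {b j}. u v * Poly_Mapping.lookup v (lead j)) = 0"
    by (rule sum.neutral) (use vanish in blast)
  have "0 = Poly_Mapping.lookup (\<Sum>v\<in>t. Poly_Mapping.single 0 (u v) * v) (lead j)" by (simp add: zero)
  also have "\<dots> = (\<Sum>v\<in>t. u v * Poly_Mapping.lookup v (lead j))"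
    by (simp add: lookup_sum lookup_single_zero_mult)
  also have "\<dots> = u (b j) * Poly_Mapping.lookup (b j) (lead j)"
    using t jJ rest by (simp add: sum.remove)
  finally show False using jJ lookup_lead[OF jJ(1)] by simp
qed

text \<open>
  The coordinate function of the basis, indexed by \<open>J\<close> rather than by the basis vectors themselves.
\<close>

definition coeff :: "('k \<Rightarrow>\<^sub>0 'c) \<Rightarrow> 'j \<Rightarrow> 'c" where
  "coeff f j = monoid_algebra.representation (b ` J) f (b j)"

lemma coeff_basis: "i \<in> J \<Longrightarrow> j \<in> J \<Longrightarrow> coeff (b i) j = (if i = j then 1 else 0)"
  using inj_on_family
  by (auto simp: coeff_def monoid_algebra.representation_basis[OF independent_family] inj_on_eq_iff)

lemma coeff_zero [simp]: "coeff 0 j = 0"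
  by (simp add: coeff_def monoid_algebra.representation_zero)

lemma coeff_add:
  "f \<in> monoid_algebra.span (b ` J) \<Longrightarrow> g \<in> monoid_algebra.span (b ` J) \<Longrightarrow>
    coeff (f + g) j = coeff f j + coeff g j"
  by (simp add: coeff_def monoid_algebra.representation_add[OF independent_family])

lemma coeff_diff:
  "f \<in> monoid_algebra.span (b ` J) \<Longrightarrow> g \<in> monoid_algebra.span (b ` J) \<Longrightarrow>
    coeff (f - g) j = coeff f j - coeff g j"
  by (simp add: coeff_def monoid_algebra.representation_diff[OF independent_family])

lemma coeff_scale:
  "f \<in> monoid_algebra.span (b ` J) \<Longrightarrow> coeff (Poly_Mapping.single 0 c * f) j = c * coeff f j"
  by (simp add: coeff_def monoid_algebra.representation_scale[OF independent_family])

lemma coeff_sum: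
  "(\<And>i. i \<in> I \<Longrightarrow> f i \<in> monoid_algebra.span (b ` J)) \<Longrightarrow> coeff (\<Sum>i\<in>I. f i) j = (\<Sum>i\<in>I. coeff (f i) j)"
  by (simp add: coeff_def monoid_algebra.representation_sum[OF independent_family])

lemma in_span_subfamily_iff:
  assumes S: "S \<subseteq> J"
  shows "f \<in> monoid_algebra.span (b ` S) \<longleftrightarrow>
    f \<in> monoid_algebra.span (b ` J) \<and> (\<forall>j\<in>J - S. coeff f j = 0)"
proof (intro iffI conjI ballI)
  assume f: "f \<in> monoid_algebra.span (b ` S)"
  show "f \<in> monoid_algebra.span (b ` J)"
    using f monoid_algebra.span_mono[OF image_mono[OF S]] by blast
  fix j assume j: "j \<in> J - S"
  then have "b j \<notin> b ` S" using inj_on_image_mem_iff[OF inj_on_family] S by simp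
  moreover have "coeff f j = monoid_algebra.representation (b ` S) f (b j)"
    unfolding coeff_def
    by (subst monoid_algebra.representation_extend[OF independent_family f image_mono[OF S]]) simp
  ultimately show "coeff f j = 0" using monoid_algebra.representation_ne_zero by metis
next
  assume *: "f \<in> monoid_algebra.span (b ` J) \<and> (\<forall>j\<in>J - S. coeff f j = 0)"
  let ?R = "monoid_algebra.representation (b ` J) f"
  have "f = (\<Sum>v | ?R v \<noteq> 0. Poly_Mapping.single 0 (?R v) * v)"
    using monoid_algebra.sum_nonzero_representation_eq[OF independent_family] * by simp
  also have "\<dots> \<in> monoid_algebra.span (b ` S)"
  proof (intro monoid_algebra.span_sum monoid_algebra.span_scale monoid_algebra.span_base)
    fix v assume v: "v \<in> {v. ?R v \<noteq> 0}"
    then have "v \<in> b ` J" using monoid_algebra.representation_ne_zero by blast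
    then obtain j where "j \<in> J" "v = b j" by blast
    then show "v \<in> b ` S" using v * by (cases "j \<in> S") (auto simp: coeff_def)
  qed
  finally show "f \<in> monoid_algebra.span (b ` S)" .
qed

lemma coeff_sum_eq:
  assumes "finite S" "S \<subseteq> J" "f \<in> monoid_algebra.span (b ` S)"
  shows "f = (\<Sum>j\<in>S. Poly_Mapping.single 0 (coeff f j) * b j)"
proof -
  have ind: "monoid_algebra.independent (b ` S)"
    using monoid_algebra.independent_mono[OF independent_family image_mono[OF assms(2)]] .
  have "f = (\<Sum>v\<in>b ` S. Poly_Mapping.single 0 (monoid_algebra.representation (b ` S) f v) * v)"
    using monoid_algebra.sum_representation_eq[OF ind assms(3)] assms(1) by simp
  also have "monoid_algebra.representation (b ` S) f = monoid_algebra.representation (b ` J) f"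
    using monoid_algebra.representation_extend[OF independent_family assms(3) image_mono[OF assms(2)]] by simp
  finally show ?thesis
    using inj_on_subset[OF inj_on_family assms(2)] by (simp add: sum.reindex coeff_def)
qed

end

section \<open>Products of a descent monomial with the parameters\<close>

lemma dilation_points_hypercube:
  "dilation_points hypercube r = {v :: int^'d. \<forall>x. 0 \<le> v $ x \<and> v $ x \<le> int r}"
proof (intro equalityI subsetI)
  fix v :: "int^'d" assume "v \<in> dilation_points hypercube r"
  then obtain p where p: "p \<in> hypercube" "(\<chi> i. real_of_int (v $ i)) = real r *\<^sub>R p"
    by (auto simp: dilation_points_def)
  have "0 \<le> v $ x \<and> v $ x \<le> int r" for x
  proof -
    have "real_of_int (v $ x) = real r * (p $ x)"
      using arg_cong[OF p(2), of "\<lambda>w. w $ x"] by simp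
    then have "0 \<le> real_of_int (v $ x)" "real_of_int (v $ x) \<le> real_of_int (int r)"
      using p(1) by (simp_all add: hypercube_def mult_left_le)
    then show ?thesis by (simp only: of_int_0_le_iff of_int_le_iff)
  qed
  then show "v \<in> {v. \<forall>x. 0 \<le> v $ x \<and> v $ x \<le> int r}"
    by simp
next
  fix v :: "int^'d" assume "v \<in> {v. \<forall>x. 0 \<le> v $ x \<and> v $ x \<le> int r}"
  then have v: "0 \<le> v $ x" "v $ x \<le> int r" for x by auto
  define p :: "real^'d" where "p = (\<chi> x. real_of_int (v $ x) / real r)"
  have "p \<in> hypercube"
    unfolding hypercube_def mem_Collect_eq
  proof
    fix x
    have "0 \<le> real_of_int (v $ x)" "real_of_int (v $ x) \<le> real_of_int (int r)"
      using v[of x] by (simp_all only: of_int_0_le_iff of_int_le_iff)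
    then show "0 \<le> p $ x \<and> p $ x \<le> 1"
      by (cases "r = 0") (simp_all add: p_def)
  qed
  moreover have "(\<chi> i. real_of_int (v $ i)) = real r *\<^sub>R p"
  proof (cases "r = 0")
    case True
    then have "v $ x = 0" for x using v[of x] by simp
    then show ?thesis using True by (simp add: vec_eq_iff)
  qed (simp add: vec_eq_iff p_def)
  ultimately show "v \<in> dilation_points hypercube r"
    by (auto simp: dilation_points_def)
qed

definition cube_monomials :: "((int^'d) \<times> nat) set" where
  "cube_monomials = {(u, r). \<forall>x. 0 \<le> u $ x \<and> u $ x \<le> int r}"

lemma carrier_cube_ring: "carrier cube_ring = {f. Poly_Mapping.keys f \<subseteq> cube_monomials}"
  by (auto simp: polytope_ring_def dilation_points_hypercube cube_monomials_def)

lemma inj_on_ind: "inj_on (ind :: nat set \<Rightarrow> int^'d::finite) (Pow {1..CARD('d)})"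
proof (rule inj_onI)
  fix G H assume GH: "G \<in> Pow {1..CARD('d)}" "H \<in> Pow {1..CARD('d)}" "(ind G :: int^'d) = ind H"
  then have "idx x \<in> G \<longleftrightarrow> idx x \<in> H" for x :: 'd
    by (auto simp: ind_def vec_eq_iff of_bool_def split: if_splits)
  moreover have "\<exists>x :: 'd. j = idx x" if "j \<in> {1..CARD('d)}" for j
    using that bij_idx by (auto simp: bij_betw_def)
  ultimately show "G = H" using GH by blast
qed

lemma y_elem_eq:
  "(y_elem k :: 'd::finite lattice_algebra)
    = (\<Sum>G\<in>{G. G \<subseteq> {1..CARD('d)} \<and> card G = k}. x_sym (ind G) 1)"
proof -
  have "{v :: int^'d. v \<in> dilation_points hypercube 1 \<and> weight sym_weights v = int k}
      = ind ` {G. G \<subseteq> {1..CARD('d)} \<and> card G = k}" (is "?L = ?R")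
  proof (intro equalityI subsetI)
    fix v :: "int^'d" assume v: "v \<in> ?L"
    define G :: "nat set" where "G = idx ` {x. v $ x = 1}"
    have G: "G \<subseteq> {1..CARD('d)}" using idx_in[where 'd = 'd] by (simp add: G_def image_subset_iff)
    have "v $ x = 0 \<or> v $ x = 1" for x
    proof -
      have "0 \<le> v $ x" "v $ x \<le> 1" using v by (auto simp: dilation_points_hypercube)
      then show ?thesis by linarith
    qed
    moreover have "idx x \<in> G \<longleftrightarrow> v $ x = 1" for x
      using bij_idx by (auto simp: G_def bij_betw_def inj_on_def)
    ultimately have "v = ind G" by (auto simp: ind_def vec_eq_iff)
    moreover have "card G = k"
      using weight_indicators[of "{()}" "\<lambda>_. G", where 'd = 'd] G v \<open>v = ind G\<close> by simp
    ultimately show "v \<in> ?R" using G by blast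
  next
    fix v :: "int^'d" assume "v \<in> ?R"
    then obtain G where G: "v = ind G" "G \<subseteq> {1..CARD('d)}" "card G = k" by blast
    then show "v \<in> ?L"
      using weight_indicators[of "{()}" "\<lambda>_. G", where 'd = 'd]
      by (auto simp: dilation_points_hypercube ind_def)
  qed
  moreover have "inj_on (ind :: nat set \<Rightarrow> int^'d) {G. G \<subseteq> {1..CARD('d)} \<and> card G = k}"
    by (rule inj_on_subset[OF inj_on_ind]) auto
  ultimately show ?thesis by (simp add: y_elem_def sum.reindex)
qed

text \<open>
  One slot per factor of \<open>b(\<sigma>, a)\<close>: the slots \<open>(i, 1), \<dots>, (i, a i)\<close> stand for the factors \<open>y_elem i\<close>, and the
  slot \<open>(i, 0)\<close>, present only at a descent \<open>i\<close>, for the factor of the descent monomial. In the product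
  one set is chosen per slot, from \<open>choices\<close>.
\<close>

definition slots :: "nat \<Rightarrow> (nat \<Rightarrow> nat) \<Rightarrow> (nat \<Rightarrow> nat) \<Rightarrow> (nat \<times> nat) set" where
  "slots d \<sigma> a = (SIGMA i:{0..d}. {k. k \<le> a i \<and> (k = 0 \<longrightarrow> i \<in> descent_positions d \<sigma>)})"

definition choices :: "nat \<Rightarrow> (nat \<Rightarrow> nat) \<Rightarrow> nat \<times> nat \<Rightarrow> nat set set" where
  "choices d \<sigma> = (\<lambda>(i, k). if k = 0 then {\<sigma> ` {1..i}} else {G. G \<subseteq> {1..d} \<and> card G = i})"

definition basis_elem :: "(nat \<Rightarrow> nat) \<Rightarrow> (nat \<Rightarrow> nat) \<Rightarrow> 'd::finite lattice_algebra" where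
  "basis_elem \<sigma> a = (\<Prod>i\<in>{0..CARD('d)}. y_elem i ^ a i) *
     (\<Prod>i\<in>descent_positions CARD('d) \<sigma>. x_sym (ind (\<sigma> ` {1..i})) 1)"

definition lead_monomial :: "(nat \<Rightarrow> nat) \<Rightarrow> (nat \<Rightarrow> nat) \<Rightarrow> (int^'d::finite) \<times> nat" where
  "lead_monomial \<sigma> a =
     (\<Sum>\<alpha>\<in>slots CARD('d) \<sigma> a. ind (\<sigma> ` {1..fst \<alpha>}), card (slots CARD('d) \<sigma> a))"

lemma descent_positions_subset: "descent_positions d \<sigma> \<subseteq> {1..<d}"
  by (auto simp: descent_positions_def)

lemma finite_descent_positions [simp]: "finite (descent_positions d \<sigma>)"
  using descent_positions_subset finite_subset by blast

lemma finite_slots [simp]: "finite (slots d \<sigma> a)"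
  by (simp add: slots_def)

lemma slots_fibre:
  "{k. k \<le> a i \<and> (k = (0::nat) \<longrightarrow> i \<in> D)} = (if i \<in> D then insert 0 {1..a i} else {1..a i})"
  by auto

lemma sum_slots:
  fixes h :: "nat \<Rightarrow> 'b::comm_semiring_1"
  shows "(\<Sum>\<alpha>\<in>slots d \<sigma> a. h (fst \<alpha>))
    = (\<Sum>i\<in>{0..d}. of_nat (a i + of_bool (i \<in> descent_positions d \<sigma>)) * h i)"
proof -
  have "(\<Sum>\<alpha>\<in>slots d \<sigma> a. h (fst \<alpha>))
    = (\<Sum>i\<in>{0..d}. \<Sum>k\<in>{k. k \<le> a i \<and> (k = 0 \<longrightarrow> i \<in> descent_positions d \<sigma>)}. h i)"
    unfolding slots_def by (subst sum.Sigma) (auto simp: case_prod_beta)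
  also have "\<dots> = (\<Sum>i\<in>{0..d}. of_nat (a i + of_bool (i \<in> descent_positions d \<sigma>)) * h i)"
    by (intro sum.cong refl) (simp add: slots_fibre add.commute)
  finally show ?thesis .
qed

lemma x_sym_mult: "x_sym v r * x_sym w s = x_sym (v + w) (r + s)"
  by (simp add: x_sym_def mult_single)

lemma prod_x_sym:
  "finite I \<Longrightarrow> (\<Prod>\<alpha>\<in>I. x_sym (v \<alpha>) 1) = x_sym (\<Sum>\<alpha>\<in>I. v \<alpha>) (card I)"
proof (induction I rule: finite_induct)
  case empty
  show ?case by (simp add: x_sym_def zero_prod_def[symmetric])
qed (simp add: x_sym_mult)

lemma choicesD:
  assumes "\<sigma> permutes {1..d}" "g \<in> PiE (slots d \<sigma> a) (choices d \<sigma>)" "\<alpha> \<in> slots d \<sigma> a"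
  shows "g \<alpha> \<subseteq> {1..d}" "card (g \<alpha>) = fst \<alpha>"
proof -
  have "fst \<alpha> \<le> d" using assms(3) by (auto simp: slots_def)
  moreover have "g \<alpha> \<in> choices d \<sigma> \<alpha>" using assms(2,3) by blast
  ultimately show "g \<alpha> \<subseteq> {1..d}" "card (g \<alpha>) = fst \<alpha>"
    using card_image_initial[OF assms(1), of "fst \<alpha>"] image_initial_subset[OF assms(1), of "fst \<alpha>"]
    by (auto simp: choices_def split: prod.splits if_splits)
qed

lemma finite_choices: "finite (choices d \<sigma> \<alpha>)"
  by (cases \<alpha>) (auto simp: choices_def intro: finite_subset[of _ "Pow {1..d}"])

lemma basis_elem_expansion:
  fixes \<sigma> a
  defines "I \<equiv> slots CARD('d::finite) \<sigma> a"
  shows "(basis_elem \<sigma> a :: 'd lattice_algebra)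
    = (\<Sum>g\<in>PiE I (choices CARD('d) \<sigma>). x_sym (\<Sum>\<alpha>\<in>I. ind (g \<alpha>)) (card I))"
proof -
  let ?D = "descent_positions CARD('d) \<sigma>"
  let ?x = "\<lambda>G. x_sym (ind G) 1 :: 'd lattice_algebra"
  have "(basis_elem \<sigma> a :: 'd lattice_algebra)
      = (\<Prod>i\<in>{0..CARD('d)}. y_elem i ^ a i) * (\<Prod>i\<in>{0..CARD('d)}. if i \<in> ?D then ?x (\<sigma> ` {1..i}) else 1)"
  proof -
    have "{0..CARD('d)} \<inter> ?D = ?D" using descent_positions_subset[of "CARD('d)" \<sigma>] by fastforce
    then show ?thesis by (simp add: basis_elem_def prod.inter_restrict[symmetric])
  qed
  also have "\<dots> = (\<Prod>i\<in>{0..CARD('d)}. y_elem i ^ a i * (if i \<in> ?D then ?x (\<sigma> ` {1..i}) else 1))"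
    by (rule prod.distrib[symmetric])
  also have "\<dots> = (\<Prod>i\<in>{0..CARD('d)}. \<Prod>k\<in>{k. k \<le> a i \<and> (k = 0 \<longrightarrow> i \<in> ?D)}.
       \<Sum>G\<in>choices CARD('d) \<sigma> (i, k). ?x G)"
  proof (intro prod.cong refl)
    fix i
    have "(\<Prod>k\<in>{1..a i}. \<Sum>G\<in>choices CARD('d) \<sigma> (i, k). ?x G) = (\<Prod>k\<in>{1..a i}. y_elem i)"
      by (intro prod.cong) (auto simp: choices_def y_elem_eq)
    then show "y_elem i ^ a i * (if i \<in> ?D then ?x (\<sigma> ` {1..i}) else 1)
       = (\<Prod>k\<in>{k. k \<le> a i \<and> (k = 0 \<longrightarrow> i \<in> ?D)}. \<Sum>G\<in>choices CARD('d) \<sigma> (i, k). ?x G)"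
      by (simp add: slots_fibre) (simp add: choices_def mult.commute)
  qed
  also have "\<dots> = (\<Prod>\<alpha>\<in>I. \<Sum>G\<in>choices CARD('d) \<sigma> \<alpha>. ?x G)"
    unfolding I_def slots_def by (subst prod.Sigma) (auto simp: case_prod_beta)
  also have "\<dots> = (\<Sum>g\<in>PiE I (choices CARD('d) \<sigma>). \<Prod>\<alpha>\<in>I. ?x (g \<alpha>))"
    by (rule prod_sum_PiE) (auto simp: I_def finite_choices)
  also have "\<dots> = (\<Sum>g\<in>PiE I (choices CARD('d) \<sigma>). x_sym (\<Sum>\<alpha>\<in>I. ind (g \<alpha>)) (card I))"
    by (intro sum.cong refl prod_x_sym) (simp add: I_def)
  finally show ?thesis .
qed

text \<open>
  The slots \<open>(j, 0)\<close> force every nested choice to contain the chain of the sets \<open>\<sigma> ` {1..j}\<close> at the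
  descents \<open>j\<close>, which is what \<open>sum_image_initial_less\<close> asks for.
\<close>

lemma potential_choice_less:
  fixes \<sigma> a
  defines "I \<equiv> slots CARD('d::finite) \<sigma> a"
  assumes \<sigma>: "\<sigma> permutes {1..CARD('d)}" and g: "g \<in> PiE I (choices CARD('d) \<sigma>)"
    and ne: "g \<noteq> (\<lambda>\<alpha>\<in>I. \<sigma> ` {1..fst \<alpha>})"
  shows "potential (\<Sum>\<alpha>\<in>I. ind (g \<alpha>) :: int^'d, card I) < potential (lead_monomial \<sigma> a :: (int^'d) \<times> nat)"
  unfolding lead_monomial_def I_def[symmetric]
proof (rule potential_indicators_less)
  let ?D = "descent_positions CARD('d) \<sigma>"
  note gD = choicesD[OF \<sigma> g[unfolded I_def], folded I_def]
  show "finite I" by (simp add: I_def)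
  have le: "fst \<alpha> \<le> CARD('d)" if "\<alpha> \<in> I" for \<alpha> using that by (auto simp: I_def slots_def)
  show "\<sigma> ` {1..fst \<alpha>} \<subseteq> {1..CARD('d)}" if "\<alpha> \<in> I" for \<alpha>
    using image_initial_subset[OF \<sigma> le[OF that]] .
  show "g \<alpha> \<subseteq> {1..CARD('d)}" if "\<alpha> \<in> I" for \<alpha> by (rule gD(1)[OF that])
  show "card (g \<alpha>) = card (\<sigma> ` {1..fst \<alpha>})" if "\<alpha> \<in> I" for \<alpha>
    using gD(2)[OF that] card_image_initial[OF \<sigma>] by simp
  show "\<sigma> ` {1..fst \<alpha>} \<subseteq> \<sigma> ` {1..fst \<beta>} \<or> \<sigma> ` {1..fst \<beta>} \<subseteq> \<sigma> ` {1..fst \<alpha>}" for \<alpha> \<beta> :: "nat \<times> nat"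
    by (cases "fst \<alpha> \<le> fst \<beta>") (auto intro!: image_mono simp del: image_subset_iff)
  show "\<exists>\<alpha>\<in>I. g \<alpha> \<noteq> \<sigma> ` {1..fst \<alpha>}"
  proof (rule ccontr)
    assume "\<not> ?thesis"
    then have "g = (\<lambda>\<alpha>\<in>I. \<sigma> ` {1..fst \<alpha>})"
      using PiE_arb[OF g] by (intro ext) (simp add: restrict_def)
    then show False using ne by simp
  qed
  fix \<alpha> assume \<alpha>: "\<alpha> \<in> I" "g \<alpha> \<noteq> \<sigma> ` {1..fst \<alpha>}"
    and nested: "\<And>\<beta> \<gamma>. \<beta> \<in> I \<Longrightarrow> \<gamma> \<in> I \<Longrightarrow> card (g \<beta>) \<le> card (g \<gamma>) \<Longrightarrow> g \<beta> \<subseteq> g \<gamma>"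
  have desc: "(j, 0) \<in> I \<and> g (j, 0) = \<sigma> ` {1..j} \<and> card (g (j, 0)) = j" if "j \<in> ?D" for j
  proof -
    have I: "(j, 0) \<in> I" using that descent_positions_subset by (force simp: I_def slots_def)
    then have "g (j, 0) \<in> choices CARD('d) \<sigma> (j, 0)" using g by blast
    then show ?thesis using I gD(2)[OF I] by (simp add: choices_def)
  qed
  have c: "card (g \<alpha>) = fst \<alpha>" by (rule gD(2)[OF \<alpha>(1)])
  have "\<Sum> (\<sigma> ` {1..card (g \<alpha>)}) < \<Sum> (g \<alpha>)"
  proof (rule sum_image_initial_less[OF \<sigma> gD(1)[OF \<alpha>(1)]])
    show "g \<alpha> \<noteq> \<sigma> ` {1..card (g \<alpha>)}" using \<alpha> c by simp
    show "\<sigma> ` {1..j} \<subseteq> g \<alpha>" if "j \<in> ?D" "j \<le> card (g \<alpha>)" for j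
      using nested[of "(j, 0)" \<alpha>] desc[OF that(1)] that \<alpha>
      by (metis (no_types))
    show "g \<alpha> \<subseteq> \<sigma> ` {1..j}" if "j \<in> ?D" "card (g \<alpha>) \<le> j" for j
      using nested[of \<alpha> "(j, 0)"] desc[OF that(1)] that \<alpha>
      by (metis (no_types))
  qed
  then show "\<Sum> (\<sigma> ` {1..fst \<alpha>}) < \<Sum> (g \<alpha>)" by (simp add: c)
qed

text \<open>
  The leading coefficient is 1 because only one choice function reaches the maximal potential. In
  each monomial the bidegree is determined by the slots, as the chosen sets have prescribed sizes.
\<close>

lemma
  fixes \<sigma> a
  assumes \<sigma>: "\<sigma> permutes {1..CARD('d::finite)}"
  shows lookup_lead_monomial:
      "Poly_Mapping.lookup (basis_elem \<sigma> a :: 'd lattice_algebra) (lead_monomial \<sigma> a) = 1"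
    and potential_less_lead: "m \<in> Poly_Mapping.keys (basis_elem \<sigma> a :: 'd lattice_algebra) \<Longrightarrow>
      m \<noteq> lead_monomial \<sigma> a \<Longrightarrow> potential m < potential (lead_monomial \<sigma> a :: (int^'d) \<times> nat)"
    and keys_basis_elem: "m \<in> Poly_Mapping.keys (basis_elem \<sigma> a :: 'd lattice_algebra) \<Longrightarrow>
      m \<in> cube_monomials \<and> snd m = card (slots CARD('d) \<sigma> a)
      \<and> weight sym_weights (fst m) = int (\<Sum>\<alpha>\<in>slots CARD('d) \<sigma> a. fst \<alpha>)"
proof -
  define I where "I = slots CARD('d) \<sigma> a"
  define P where "P = PiE I (choices CARD('d) \<sigma>)"
  define top where "top = (\<lambda>\<alpha>\<in>I. \<sigma> ` {1..fst \<alpha>})"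
  define mono where "mono g = (\<Sum>\<alpha>\<in>I. ind (g \<alpha>) :: int^'d, card I)" for g :: "nat \<times> nat \<Rightarrow> nat set"
  have fP: "finite P" unfolding P_def by (intro finite_PiE) (auto simp: finite_choices I_def)
  have le: "fst \<alpha> \<le> CARD('d)" if "\<alpha> \<in> I" for \<alpha> using that by (auto simp: I_def slots_def)
  have top: "top \<in> P"
    using card_image_initial[OF \<sigma>] image_initial_subset[OF \<sigma>] le
    by (auto simp: P_def top_def choices_def intro!: restrict_PiE_iff[THEN iffD2] split: prod.splits)
  have mtop: "mono top = lead_monomial \<sigma> a"
    by (simp add: mono_def lead_monomial_def I_def[symmetric] top_def)
  have less: "potential (mono g) < potential (lead_monomial \<sigma> a :: (int^'d) \<times> nat)"
    if "g \<in> P" "g \<noteq> top" for g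
    using potential_choice_less[OF \<sigma>, of g a] that by (simp add: P_def top_def mono_def I_def)
  have lookup: "Poly_Mapping.lookup (basis_elem \<sigma> a :: 'd lattice_algebra) m
      = (\<Sum>g\<in>P. if mono g = m then 1 else 0)" for m
    by (simp add: basis_elem_expansion lookup_sum x_sym_def lookup_single when_def
          P_def I_def mono_def)
  have key: "\<exists>g\<in>P. m = mono g" if "m \<in> Poly_Mapping.keys (basis_elem \<sigma> a :: 'd lattice_algebra)" for m
  proof (rule ccontr)
    assume "\<not> ?thesis"
    then have "Poly_Mapping.lookup (basis_elem \<sigma> a :: 'd lattice_algebra) m = 0"
      unfolding lookup by (intro sum.neutral) auto
    then show False using that by (simp add: in_keys_iff)
  qed
  have "Poly_Mapping.lookup (basis_elem \<sigma> a :: 'd lattice_algebra) (lead_monomial \<sigma> a)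
      = (\<Sum>g\<in>P. if g = top then 1 else 0)"
    unfolding lookup using mtop less by (intro sum.cong refl) force
  then show "Poly_Mapping.lookup (basis_elem \<sigma> a :: 'd lattice_algebra) (lead_monomial \<sigma> a) = 1"
    using fP top by simp
  show "potential m < potential (lead_monomial \<sigma> a :: (int^'d) \<times> nat)"
    if "m \<in> Poly_Mapping.keys (basis_elem \<sigma> a :: 'd lattice_algebra)" "m \<noteq> lead_monomial \<sigma> a"
    using key[OF that(1)] that(2) less mtop by metis
  assume "m \<in> Poly_Mapping.keys (basis_elem \<sigma> a :: 'd lattice_algebra)"
  then obtain g where g: "g \<in> P" "m = mono g" using key by blast
  note gD = choicesD[OF \<sigma> g(1)[unfolded P_def I_def], folded I_def]
  have "(\<Sum>\<alpha>\<in>I. of_bool (idx x \<in> g \<alpha>) :: int) \<le> (\<Sum>\<alpha>\<in>I. 1)" for x :: 'd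
    by (intro sum_mono) auto
  then have "m \<in> cube_monomials"
    by (auto simp: g mono_def cube_monomials_def ind_def intro!: sum_nonneg)
  moreover have "weight sym_weights (fst m) = int (\<Sum>\<alpha>\<in>I. fst \<alpha>)"
    using weight_indicators[of I g, where 'd = 'd] gD by (simp add: g mono_def)
  ultimately show "m \<in> cube_monomials \<and> snd m = card (slots CARD('d) \<sigma> a)
      \<and> weight sym_weights (fst m) = int (\<Sum>\<alpha>\<in>slots CARD('d) \<sigma> a. fst \<alpha>)"
    by (simp add: g mono_def I_def)
qed

section \<open>Every monomial is a leading monomial exactly once\<close>

text \<open>
  Exponents beyond \<open>d\<close> are required to vanish so that distinct indices have distinct basis elements.
\<close>

definition basis_index :: "nat \<Rightarrow> ((nat \<Rightarrow> nat) \<times> (nat \<Rightarrow> nat)) set" where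
  "basis_index d = {(\<sigma>, a). \<sigma> permutes {1..d} \<and> (\<forall>i>d. a i = 0)}"

text \<open>
  The entry of the leading monomial at position \<open>\<sigma> j\<close>: the number of slots \<open>(i, k)\<close> with \<open>j \<le> i\<close>. At
  \<open>j = 0\<close> this is the number of all slots, that is, the degree.
\<close>

definition tail_sum :: "nat \<Rightarrow> (nat \<Rightarrow> nat) \<Rightarrow> (nat \<Rightarrow> nat) \<Rightarrow> nat \<Rightarrow> nat" where
  "tail_sum d \<sigma> a j = (\<Sum>i\<in>{j..d}. a i + of_bool (i \<in> descent_positions d \<sigma>))"

lemma tail_sum_Suc:
  "j \<le> d \<Longrightarrow> tail_sum d \<sigma> a j = a j + of_bool (j \<in> descent_positions d \<sigma>) + tail_sum d \<sigma> a (Suc j)"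
  by (simp add: tail_sum_def sum.atLeast_Suc_atMost)

lemma tail_sum_antimono: "i \<le> j \<Longrightarrow> tail_sum d \<sigma> a j \<le> tail_sum d \<sigma> a i"
  unfolding tail_sum_def by (rule sum_mono2) auto

lemma card_slots: "card (slots d \<sigma> a) = tail_sum d \<sigma> a 0"
  using sum_slots[of "\<lambda>_. 1 :: nat" d \<sigma> a] by (simp add: tail_sum_def)

lemma lead_monomial_eq:
  assumes \<sigma>: "\<sigma> permutes {1..CARD('d::finite)}"
  shows "(lead_monomial \<sigma> a :: (int^'d) \<times> nat)
    = (\<chi> x. int (tail_sum CARD('d) \<sigma> a (inv_into UNIV \<sigma> (idx x))), tail_sum CARD('d) \<sigma> a 0)"
proof -
  have "(\<Sum>\<alpha>\<in>slots CARD('d) \<sigma> a. ind (\<sigma> ` {1..fst \<alpha>}) :: int^'d) $ x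
      = int (tail_sum CARD('d) \<sigma> a (inv_into UNIV \<sigma> (idx x)))" for x
  proof -
    define j where "j = inv_into UNIV \<sigma> (idx x)"
    have "idx x \<in> {1..CARD('d)}" by (rule idx_in)
    then have j: "j \<in> {1..CARD('d)}"
      unfolding j_def using permutes_in_image[OF permutes_inv[OF \<sigma>]] by blast
    have x: "idx x = \<sigma> j" by (simp add: j_def permutes_inverses[OF \<sigma>])
    have mem: "idx x \<in> \<sigma> ` {1..i} \<longleftrightarrow> j \<le> i" for i
      unfolding x using j by (auto simp: inj_image_mem_iff[OF permutes_inj[OF \<sigma>]])
    have "(\<Sum>\<alpha>\<in>slots CARD('d) \<sigma> a. ind (\<sigma> ` {1..fst \<alpha>}) :: int^'d) $ x
        = (\<Sum>\<alpha>\<in>slots CARD('d) \<sigma> a. of_bool (j \<le> fst \<alpha>))"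
      unfolding sum_component ind_def vec_lambda_beta mem ..
    also have "\<dots> = (\<Sum>i\<in>{0..CARD('d)}. of_nat (a i + of_bool (i \<in> descent_positions CARD('d) \<sigma>)) * of_bool (j \<le> i))"
      by (rule sum_slots)
    also have "\<dots> = (\<Sum>i\<in>{j..CARD('d)}. of_nat (a i + of_bool (i \<in> descent_positions CARD('d) \<sigma>)))"
      by (rule sum.mono_neutral_cong_right) auto
    finally show ?thesis by (simp add: tail_sum_def j_def)
  qed
  then show ?thesis by (simp add: lead_monomial_def vec_eq_iff card_slots)
qed

lemma mult_add_less_iff:
  fixes A B p q d :: nat
  assumes "p \<le> d" "q \<le> d"
  shows "A * Suc d + p < B * Suc d + q \<longleftrightarrow> A < B \<or> A = B \<and> p < q"
proof -
  have "A * Suc d + p < B * Suc d + q" if "A < B" "p \<le> d" for A B p q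
  proof -
    have "Suc A * Suc d \<le> B * Suc d" using that by (intro mult_le_mono1) auto
    then show ?thesis using that by simp
  qed
  from this[of A B p q] this[of B A q p] show ?thesis
    using assms by (cases A B rule: linorder_cases) auto
qed

lemma strict_enumeration_unique:
  fixes f g :: "nat \<Rightarrow> nat"
  assumes "\<And>j. 1 \<le> j \<Longrightarrow> j < d \<Longrightarrow> f j < f (Suc j)" "\<And>j. 1 \<le> j \<Longrightarrow> j < d \<Longrightarrow> g j < g (Suc j)"
    and "f ` {1..d} = g ` {1..d}" and "j \<in> {1..d}"
  shows "f j = g j"
proof -
  have "sorted_wrt (<) (map h [1..<Suc d])" if "\<And>j. 1 \<le> j \<Longrightarrow> j < d \<Longrightarrow> h j < h (Suc j)" for h :: "nat \<Rightarrow> nat"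
    using that by (subst sorted_wrt_iff_nth_Suc_transp) (auto simp: transp_def simp del: upt_Suc)
  from this[of f] this[of g] have "map f [1..<Suc d] = map g [1..<Suc d]"
    using assms(1-3) by (intro strict_sorted_equal) (auto simp: atLeastLessThanSuc_atLeastAtMost simp del: upt_Suc)
  then have "\<forall>i\<in>{1..<Suc d}. f i = g i" by (simp del: upt_Suc)
  then show ?thesis using assms(4) by auto
qed

lemma ex_sorting_permutation:
  fixes \<kappa> :: "nat \<Rightarrow> nat"
  assumes "inj_on \<kappa> {1..d}"
  obtains \<sigma> where "\<sigma> permutes {1..d}" "\<And>j. 1 \<le> j \<Longrightarrow> j < d \<Longrightarrow> \<kappa> (\<sigma> j) < \<kappa> (\<sigma> (Suc j))"
proof -
  define xs where "xs = sorted_list_of_set (\<kappa> ` {1..d})"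
  have len: "length xs = d" and set: "set xs = \<kappa> ` {1..d}"
    and sorted: "sorted_wrt (<) xs" and dist: "distinct xs"
    using assms by (auto simp: xs_def card_image)
  have b1: "bij_betw (\<lambda>j. xs ! (j - 1)) {1..d} (\<kappa> ` {1..d})"
  proof -
    have "bij_betw (\<lambda>j. j - 1) {1..d} {..<d}"
      by (rule bij_betw_byWitness[where f' = Suc]) auto
    then show ?thesis
      using bij_betw_trans[OF _ bij_betw_nth[OF dist refl refl]] len set by (simp add: comp_def)
  qed
  have b2: "bij_betw (inv_into {1..d} \<kappa>) (\<kappa> ` {1..d}) {1..d}"
    using assms by (intro bij_betw_inv_into) (simp add: bij_betw_def)
  define \<sigma> where "\<sigma> j = (if j \<in> {1..d} then inv_into {1..d} \<kappa> (xs ! (j - 1)) else j)" for j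
  have "bij_betw \<sigma> {1..d} {1..d}"
    using bij_betw_trans[OF b1 b2] by (rule bij_betw_cong[THEN iffD1, rotated]) (simp add: \<sigma>_def)
  then have "\<sigma> permutes {1..d}" by (rule bij_imp_permutes) (auto simp: \<sigma>_def)
  moreover have \<kappa>: "\<kappa> (\<sigma> j) = xs ! (j - 1)" if "j \<in> {1..d}" for j
  proof -
    have "xs ! (j - 1) \<in> \<kappa> ` {1..d}" using b1 that by (auto simp: bij_betw_def)
    then show ?thesis using that by (simp add: \<sigma>_def f_inv_into_f)
  qed
  have "\<kappa> (\<sigma> j) < \<kappa> (\<sigma> (Suc j))" if "1 \<le> j" "j < d" for j
    using that sorted_wrt_nth_less[OF sorted, of "j - 1" j] len by (simp add: \<kappa>)
  ultimately show thesis using that by blast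
qed

text \<open>
  Along \<open>\<sigma>\<close> the entries of the leading monomial decrease weakly, and strictly at descents. Hence
  \<open>\<sigma>\<close> lists the positions by decreasing entry and, for equal entries, by increasing position. This
  order depends on the monomial only; it is encoded by the numbers \<open>\<kappa> p\<close>, so that \<open>\<sigma>\<close> and \<open>\<tau>\<close> enumerate
  the same set increasingly.
\<close>

lemma lead_monomial_inj:
  assumes \<sigma>: "\<sigma> permutes {1..CARD('d::finite)}" and \<tau>: "\<tau> permutes {1..CARD('d)}"
    and a: "\<forall>i>CARD('d). a i = 0" and b: "\<forall>i>CARD('d). b i = 0"
    and eq: "(lead_monomial \<sigma> a :: (int^'d) \<times> nat) = lead_monomial \<tau> b"
  shows "\<sigma> = \<tau> \<and> a = b"
proof -
  define d where "d = CARD('d)"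
  define g where "g p = tail_sum d \<sigma> a (inv_into UNIV \<sigma> p)" for p
  define r where "r = tail_sum d \<sigma> a 0"
  have g\<tau>: "g p = tail_sum d \<tau> b (inv_into UNIV \<tau> p)" if "p \<in> {1..d}" for p
  proof -
    have "p \<in> range (idx :: 'd \<Rightarrow> nat)"
      using that bij_idx[where 'd = 'd] by (simp add: bij_betw_def d_def)
    then obtain x :: 'd where "p = idx x" by blast
    then show ?thesis using eq unfolding lead_monomial_eq[OF \<sigma>] lead_monomial_eq[OF \<tau>]
      by (simp add: vec_eq_iff g_def d_def)
  qed
  have r\<tau>: "r = tail_sum d \<tau> b 0"
    using eq unfolding lead_monomial_eq[OF \<sigma>] lead_monomial_eq[OF \<tau>] by (simp add: r_def d_def)
  \<comment> \<open>As \<open>p \<le> d\<close>, comparing \<open>\<kappa>\<close> is comparing \<open>(r - g p, p)\<close> lexicographically.\<close>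
  define \<kappa> where "\<kappa> p = (r - g p) * Suc d + p" for p
  have incr: "\<kappa> (\<rho> j) < \<kappa> (\<rho> (Suc j))"
    if \<rho>: "\<rho> permutes {1..d}" and g: "\<And>p. p \<in> {1..d} \<Longrightarrow> g p = tail_sum d \<rho> c (inv_into UNIV \<rho> p)"
      and r: "r = tail_sum d \<rho> c 0" and j: "1 \<le> j" "j < d" for \<rho> c j
  proof -
    have in\<rho>: "\<rho> j \<in> {1..d}" "\<rho> (Suc j) \<in> {1..d}" using permutes_in_image[OF \<rho>] j by simp_all
    have gj: "g (\<rho> j) = tail_sum d \<rho> c j" "g (\<rho> (Suc j)) = tail_sum d \<rho> c (Suc j)"
      using g in\<rho> by (simp_all add: permutes_inverses[OF \<rho>])
    have le: "g (\<rho> j) \<le> r" unfolding gj r by (rule tail_sum_antimono) simp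
    have step: "g (\<rho> j) = c j + of_bool (j \<in> descent_positions d \<rho>) + g (\<rho> (Suc j))"
      unfolding gj using j by (intro tail_sum_Suc) simp
    have "\<rho> j < \<rho> (Suc j)" if "j \<notin> descent_positions d \<rho>"
    proof -
      have "\<rho> j \<noteq> \<rho> (Suc j)" using permutes_inj[OF \<rho>] by (metis injD n_not_Suc_n)
      then show ?thesis using that j by (auto simp: descent_positions_def)
    qed
    then have "r - g (\<rho> j) < r - g (\<rho> (Suc j)) \<or> r - g (\<rho> j) = r - g (\<rho> (Suc j)) \<and> \<rho> j < \<rho> (Suc j)"
      using step le by (cases "j \<in> descent_positions d \<rho>"; cases "c j = 0") auto
    then show ?thesis
      unfolding \<kappa>_def using in\<rho> by (subst mult_add_less_iff) auto
  qed
  have \<sigma>d: "\<sigma> permutes {1..d}" and \<tau>d: "\<tau> permutes {1..d}" using \<sigma> \<tau> by (simp_all add: d_def)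
  have "\<sigma> j = \<tau> j" if "j \<in> {1..d}" for j
  proof -
    have "(\<kappa> \<circ> \<sigma>) j = (\<kappa> \<circ> \<tau>) j"
    proof (rule strict_enumeration_unique[OF _ _ _ that])
      show "(\<kappa> \<circ> \<sigma>) j < (\<kappa> \<circ> \<sigma>) (Suc j)" if "1 \<le> j" "j < d" for j
        using incr[OF \<sigma>d _ r_def that] by (simp add: g_def)
      show "(\<kappa> \<circ> \<tau>) j < (\<kappa> \<circ> \<tau>) (Suc j)" if "1 \<le> j" "j < d" for j
        using incr[OF \<tau>d g\<tau> r\<tau> that] by simp
      show "(\<kappa> \<circ> \<sigma>) ` {1..d} = (\<kappa> \<circ> \<tau>) ` {1..d}"
        by (simp only: image_comp[symmetric] permutes_image[OF \<sigma>d] permutes_image[OF \<tau>d])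
    qed
    then have "\<kappa> (\<sigma> j) mod Suc d = \<kappa> (\<tau> j) mod Suc d" by simp
    moreover have "\<kappa> p mod Suc d = p" if "p \<in> {1..d}" for p
      unfolding \<kappa>_def using that by (subst mod_mult_self3) simp
    ultimately show ?thesis
      using permutes_in_image[OF \<sigma>d] permutes_in_image[OF \<tau>d] that by metis
  qed
  then have st: "\<sigma> = \<tau>"
    using permutes_not_in[OF \<sigma>d] permutes_not_in[OF \<tau>d] by (intro ext) metis
  have tails: "tail_sum d \<sigma> a i = tail_sum d \<sigma> b i" for i
  proof (cases "i \<in> {1..d}")
    case True
    then have "\<sigma> i \<in> {1..d}" using permutes_in_image[OF \<sigma>d] by simp
    then show ?thesis using g\<tau>[of "\<sigma> i"] by (simp add: g_def st[symmetric] permutes_inverses[OF \<sigma>d])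
  next
    case False
    then have "i = 0 \<or> d < i" by auto
    then show ?thesis using r_def r\<tau> by (auto simp: st[symmetric] tail_sum_def)
  qed
  have "a i = b i" for i
  proof (cases "i \<le> d")
    case True
    then show ?thesis using tail_sum_Suc[OF True, of \<sigma> a] tail_sum_Suc[OF True, of \<sigma> b] tails by simp
  next
    case False
    then show ?thesis using a b by (simp add: d_def)
  qed
  then show ?thesis using st by auto
qed

text \<open>
  Let \<open>\<sigma>\<close> sort the positions as in the injectivity argument. The sequence \<open>h\<close> consisting of the degree \<open>r\<close>,
  the sorted entries and a final zero drops by at least one at each descent of \<open>\<sigma>\<close>; the exponents
  \<open>a\<close> are the remaining drops, and then \<open>h\<close> is the sequence of tail sums.
\<close>

lemma lead_monomial_surj:
  assumes m: "(m :: (int^'d::finite) \<times> nat) \<in> cube_monomials"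
  obtains \<sigma> a where "(\<sigma>, a) \<in> basis_index CARD('d)" "lead_monomial \<sigma> a = m"
proof -
  define d where "d = CARD('d)"
  obtain v r where mv: "m = (v, r)" by (cases m)
  have v: "0 \<le> v $ x" "v $ x \<le> int r" for x using m by (auto simp: mv cube_monomials_def)
  define g where "g p = nat (v $ (inv_into UNIV idx p))" for p
  have gx: "int (g (idx x)) = v $ x" for x
  proof -
    have "inj (idx :: 'd \<Rightarrow> nat)" using bij_idx by (auto simp: bij_betw_def)
    then show ?thesis using v by (simp add: g_def)
  qed
  have gr: "g p \<le> r" for p using v(2)[of "inv_into UNIV idx p"] by (simp add: g_def nat_le_iff)
  define \<kappa> where "\<kappa> p = (r - g p) * Suc d + p" for p
  have \<kappa>mod: "\<kappa> p mod Suc d = p" if "p \<in> {1..d}" for p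
    unfolding \<kappa>_def using that by (subst mod_mult_self3) simp
  have "inj_on \<kappa> {1..d}" by (rule inj_onI) (metis \<kappa>mod)
  then obtain \<sigma> where \<sigma>: "\<sigma> permutes {1..d}"
    and incr: "\<And>j. 1 \<le> j \<Longrightarrow> j < d \<Longrightarrow> \<kappa> (\<sigma> j) < \<kappa> (\<sigma> (Suc j))"
    using ex_sorting_permutation by blast
  define h where "h j = (if j = 0 then r else if j \<le> d then g (\<sigma> j) else 0)" for j
  let ?D = "descent_positions d \<sigma>"
  define a where "a i = (if i \<le> d then h i - h (Suc i) - of_bool (i \<in> ?D) else 0)" for i
  have drop: "h (Suc j) + of_bool (j \<in> ?D) \<le> h j" if "j \<le> d" for j
  proof (cases "1 \<le> j \<and> j < d")
    case True
    then have in\<sigma>: "\<sigma> j \<in> {1..d}" "\<sigma> (Suc j) \<in> {1..d}" using permutes_in_image[OF \<sigma>] by simp_all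
    have "r - g (\<sigma> j) < r - g (\<sigma> (Suc j)) \<or> r - g (\<sigma> j) = r - g (\<sigma> (Suc j)) \<and> \<sigma> j < \<sigma> (Suc j)"
    proof (rule mult_add_less_iff[THEN iffD1])
      show "(r - g (\<sigma> j)) * Suc d + \<sigma> j < (r - g (\<sigma> (Suc j))) * Suc d + \<sigma> (Suc j)"
        using incr[of j] True unfolding \<kappa>_def by blast
    qed (use in\<sigma> in auto)
    then show ?thesis
      using True gr[of "\<sigma> j"] gr[of "\<sigma> (Suc j)"] by (auto simp: h_def descent_positions_def)
  next
    case False
    then have "j \<notin> ?D" by (auto simp: descent_positions_def)
    moreover have "j = 0 \<or> j = d" using False that by auto
    ultimately show ?thesis using gr by (auto simp: h_def)
  qed
  have tail: "tail_sum d \<sigma> a j = h j" if "j \<le> Suc d" for j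
    using that
  proof (induction j rule: inc_induct)
    case base
    show ?case by (simp add: tail_sum_def h_def)
  next
    case (step j)
    then show ?case using drop[of j] by (simp add: tail_sum_Suc a_def)
  qed
  have "lead_monomial \<sigma> a = m"
  proof -
    have "int (tail_sum d \<sigma> a (inv_into UNIV \<sigma> (idx x))) = v $ x" for x
    proof -
      have "idx x \<in> {1..d}" unfolding d_def by (rule idx_in)
      then have "inv_into UNIV \<sigma> (idx x) \<in> {1..d}" using permutes_in_image[OF permutes_inv[OF \<sigma>]] by blast
      then show ?thesis by (simp add: tail h_def permutes_inverses[OF \<sigma>] gx)
    qed
    moreover have "tail_sum d \<sigma> a 0 = r" by (simp add: tail h_def)
    ultimately show ?thesis
      using lead_monomial_eq[OF \<sigma>[unfolded d_def], of a] by (simp add: mv d_def vec_eq_iff)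
  qed
  moreover have "(\<sigma>, a) \<in> basis_index CARD('d)"
    using \<sigma> by (auto simp: basis_index_def a_def d_def)
  ultimately show thesis using that by blast
qed

section \<open>The basis of the cube ring\<close>

definition index_degree :: "nat \<Rightarrow> (nat \<Rightarrow> nat) \<times> (nat \<Rightarrow> nat) \<Rightarrow> nat \<times> int" where
  "index_degree d = (\<lambda>(\<sigma>, a). (card (slots d \<sigma> a), int (\<Sum>\<alpha>\<in>slots d \<sigma> a. fst \<alpha>)))"

lemma lead_in_keys:
  "(\<sigma>, a) \<in> basis_index CARD('d::finite) \<Longrightarrow>
    lead_monomial \<sigma> a \<in> Poly_Mapping.keys (basis_elem \<sigma> a :: 'd lattice_algebra)"
  using lookup_lead_monomial[where 'd = 'd] by (auto simp: basis_index_def in_keys_iff)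

lemma bij_lead_monomial:
  "bij_betw (\<lambda>(\<sigma>, a). lead_monomial \<sigma> a) (basis_index CARD('d)) (cube_monomials :: ((int^'d::finite) \<times> nat) set)"
proof (rule bij_betw_imageI)
  show "inj_on (\<lambda>(\<sigma>, a). lead_monomial \<sigma> a :: (int^'d) \<times> nat) (basis_index CARD('d))"
  proof (rule inj_onI)
    fix s t assume st: "s \<in> basis_index CARD('d)" "t \<in> basis_index CARD('d)"
      "(\<lambda>(\<sigma>, a). lead_monomial \<sigma> a :: (int^'d) \<times> nat) s = (\<lambda>(\<sigma>, a). lead_monomial \<sigma> a) t"
    obtain \<sigma> a \<tau> c where eq: "s = (\<sigma>, a)" "t = (\<tau>, c)" by (cases s, cases t)
    have "\<sigma> = \<tau> \<and> a = c"
      by (rule lead_monomial_inj[where 'd = 'd]) (use st eq in \<open>auto simp: basis_index_def\<close>)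
    then show "s = t" by (simp add: eq)
  qed
  show "(\<lambda>(\<sigma>, a). lead_monomial \<sigma> a) ` basis_index CARD('d) = (cube_monomials :: ((int^'d) \<times> nat) set)"
  proof (intro equalityI subsetI)
    fix m :: "(int^'d) \<times> nat" assume "m \<in> cube_monomials"
    then obtain \<sigma> a where "(\<sigma>, a) \<in> basis_index CARD('d)" "lead_monomial \<sigma> a = m"
      by (rule lead_monomial_surj)
    then show "m \<in> (\<lambda>(\<sigma>, a). lead_monomial \<sigma> a) ` basis_index CARD('d)" by force
  next
    fix m :: "(int^'d) \<times> nat" assume "m \<in> (\<lambda>(\<sigma>, a). lead_monomial \<sigma> a) ` basis_index CARD('d)"
    then obtain \<sigma> a where s: "(\<sigma>, a) \<in> basis_index CARD('d)" "m = lead_monomial \<sigma> a" by auto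
    then have "m \<in> Poly_Mapping.keys (basis_elem \<sigma> a :: 'd lattice_algebra)"
      using lead_in_keys[where 'd = 'd] by simp
    then show "m \<in> cube_monomials"
      using keys_basis_elem[where 'd = 'd and \<sigma> = \<sigma> and a = a and m = m] s by (simp add: basis_index_def)
  qed
qed

lemma index_degree_lead:
  assumes "(\<sigma>, a) \<in> basis_index CARD('d::finite)"
    and "m \<in> Poly_Mapping.keys (basis_elem \<sigma> a :: 'd lattice_algebra)"
  shows "(snd m, weight sym_weights (fst m)) = index_degree CARD('d) (\<sigma>, a)"
  using keys_basis_elem[of \<sigma> m a] assms by (auto simp: index_degree_def basis_index_def)

interpretation cube: unitriangular
  "\<lambda>(\<sigma>, a). basis_elem \<sigma> a :: 'd::finite lattice_algebra" "\<lambda>(\<sigma>, a). lead_monomial \<sigma> a"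
  "basis_index CARD('d)" cube_monomials potential
proof (unfold_locales, goal_cases)
  case 1
  show ?case by (rule bij_lead_monomial)
next
  case (2 j)
  then show ?case by (auto simp: basis_index_def lookup_lead_monomial)
next
  case (3 j)
  obtain \<sigma> a where "j = (\<sigma>, a)" by (cases j)
  then show ?case
    using 3 keys_basis_elem[where 'd = 'd and \<sigma> = \<sigma> and a = a] by (auto simp: basis_index_def)
next
  case (4 j m)
  obtain \<sigma> a where "j = (\<sigma>, a)" by (cases j)
  then show ?case
    using 4 potential_less_lead[where 'd = 'd and \<sigma> = \<sigma> and a = a and m = m] by (simp add: basis_index_def)
qed

abbreviation basis_vector :: "(nat \<Rightarrow> nat) \<times> (nat \<Rightarrow> nat) \<Rightarrow> 'd::finite lattice_algebra" where
  "basis_vector \<equiv> \<lambda>(\<sigma>, a). basis_elem \<sigma> a"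

lemma span_basis: "monoid_algebra.span (basis_vector ` basis_index CARD('d)) = carrier (cube_ring :: 'd::finite lattice_algebra ring)"
  by (simp add: cube.span_eq carrier_cube_ring)

text \<open>
  All monomials of a basis element have the same bidegree, so the leading monomials of the basis
  elements of bidegree \<open>p\<close> are exactly the monomials of bidegree \<open>p\<close>, and unitriangularity applies to
  this subfamily alone.
\<close>

lemma span_basis_bidegree:
  "monoid_algebra.span (basis_vector ` {j \<in> basis_index CARD('d). index_degree CARD('d) j = p})
    = (bidegree_part hypercube sym_weights p :: 'd::finite lattice_algebra set)"
proof -
  let ?J = "{j \<in> basis_index CARD('d). index_degree CARD('d) j = p}"
  let ?M = "{m :: (int^'d) \<times> nat. m \<in> cube_monomials \<and> (snd m, weight sym_weights (fst m)) = p}"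
  have deg: "(snd m, weight sym_weights (fst m)) = index_degree CARD('d) j"
    if "j \<in> basis_index CARD('d)" "m \<in> Poly_Mapping.keys (basis_vector j :: 'd lattice_algebra)" for j m
    using index_degree_lead[where 'd = 'd] that by (cases j) (simp only: prod.case)
  have leaddeg: "(snd m, weight sym_weights (fst m)) = index_degree CARD('d) j"
    if "j \<in> basis_index CARD('d)" "m = (\<lambda>(\<sigma>, a). lead_monomial \<sigma> a :: (int^'d) \<times> nat) j" for j m
    using deg[OF that(1)] lead_in_keys[where 'd = 'd] that by (cases j) auto
  interpret part: unitriangular
    "basis_vector :: _ \<Rightarrow> 'd lattice_algebra" "\<lambda>(\<sigma>, a). lead_monomial \<sigma> a" ?J ?M potential
  proof (unfold_locales, goal_cases)
    case 1
    show ?case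
    proof (rule bij_betw_imageI)
      show "inj_on (\<lambda>(\<sigma>, a). lead_monomial \<sigma> a :: (int^'d) \<times> nat) ?J"
        by (rule inj_on_subset[OF bij_betw_imp_inj_on[OF bij_lead_monomial]]) auto
      show "(\<lambda>(\<sigma>, a). lead_monomial \<sigma> a) ` ?J = ?M"
      proof (intro equalityI subsetI)
        fix m assume "m \<in> (\<lambda>(\<sigma>, a). lead_monomial \<sigma> a :: (int^'d) \<times> nat) ` ?J"
        then obtain j where j: "j \<in> ?J" "m = (\<lambda>(\<sigma>, a). lead_monomial \<sigma> a) j" by blast
        then show "m \<in> ?M"
          using leaddeg[of j m] bij_betw_apply[OF bij_lead_monomial[where 'd = 'd], of j] by simp
      next
        fix m assume m: "m \<in> ?M"
        then have "m \<in> (\<lambda>(\<sigma>, a). lead_monomial \<sigma> a) ` basis_index CARD('d)"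
          using bij_lead_monomial[where 'd = 'd] by (simp add: bij_betw_def)
        then obtain j where j: "j \<in> basis_index CARD('d)" "m = (\<lambda>(\<sigma>, a). lead_monomial \<sigma> a) j" by blast
        then have "j \<in> ?J" using leaddeg[of j m] m by simp
        then show "m \<in> (\<lambda>(\<sigma>, a). lead_monomial \<sigma> a) ` ?J" using j by blast
      qed
    qed
  next
    case (2 j)
    then show ?case using cube.lookup_lead[where 'd = 'd and j = j] by simp
  next
    case (3 j)
    then show ?case using cube.keys_subset[where 'd = 'd and j = j] deg[of j] by auto
  next
    case (4 j m)
    then show ?case using cube.smaller[where 'd = 'd and j = j and m = m] by simp
  qed
  have "Poly_Mapping.keys f \<subseteq> ?M \<longleftrightarrow>
      f \<in> (bidegree_part hypercube sym_weights p :: 'd lattice_algebra set)" for f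
    unfolding bidegree_part_def mem_Collect_eq carrier_cube_ring by (auto simp: subset_iff)
  then show ?thesis unfolding part.span_eq by blast
qed

section \<open>The ideals of initial segments of the parameters\<close>

lemma cring_cube_ring: "cring (cube_ring :: 'd::finite lattice_algebra ring)"
  by (rule cring_polytope_ring[OF convex_hypercube hypercube_nonempty])

interpretation cube_ring: cring "cube_ring :: 'd::finite lattice_algebra ring"
  by (rule cring_cube_ring)

lemma cube_ring_simps [simp]:
  "f \<otimes>\<^bsub>cube_ring\<^esub> g = f * g" "f \<oplus>\<^bsub>cube_ring\<^esub> g = f + g"
  "\<one>\<^bsub>cube_ring\<^esub> = 1" "\<zero>\<^bsub>cube_ring\<^esub> = 0"
  by (simp_all add: polytope_ring_def)

lemma cube_ring_uminus: "f \<in> carrier cube_ring \<Longrightarrow> \<ominus>\<^bsub>cube_ring\<^esub> f = - f"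
  by (rule cube_ring.minus_equality) (auto simp: carrier_cube_ring)

lemma cube_ring_minus:
  "f \<in> carrier cube_ring \<Longrightarrow> g \<in> carrier cube_ring \<Longrightarrow> f \<ominus>\<^bsub>cube_ring\<^esub> g = f - g"
  by (simp add: a_minus_def cube_ring_uminus)

lemma single_0_in_carrier: "Poly_Mapping.single 0 c \<in> carrier cube_ring"
  by (auto simp: carrier_cube_ring cube_monomials_def zero_prod_def split: if_splits)

lemma descent_positions_id: "descent_positions d id = {}"
  by (auto simp: descent_positions_def)

lemma basis_elem_unit: "basis_elem id (\<lambda>_. 0) = 1"
  by (simp add: basis_elem_def descent_positions_id)

lemma y_elem_mult_basis_elem:
  assumes "k \<le> CARD('d::finite)"
  shows "(y_elem k :: 'd lattice_algebra) * basis_elem \<sigma> a = basis_elem \<sigma> (a(k := Suc (a k)))"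
proof -
  have "(\<Prod>i\<in>{0..CARD('d)}. y_elem i ^ (a(k := Suc (a k))) i :: 'd lattice_algebra)
      = y_elem k ^ Suc (a k) * (\<Prod>i\<in>{0..CARD('d)} - {k}. y_elem i ^ (a(k := Suc (a k))) i)"
    using assms by (subst prod.remove[of _ k]) auto
  also have "\<dots> = y_elem k * (y_elem k ^ a k * (\<Prod>i\<in>{0..CARD('d)} - {k}. y_elem i ^ a i))"
    by (simp add: mult.assoc)
  also have "y_elem k ^ a k * (\<Prod>i\<in>{0..CARD('d)} - {k}. y_elem i ^ a i)
      = (\<Prod>i\<in>{0..CARD('d)}. y_elem i ^ a i :: 'd lattice_algebra)"
    using assms by (subst (2) prod.remove[of _ k]) auto
  finally show ?thesis by (simp add: basis_elem_def mult.assoc)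
qed

lemma y_elem_eq_basis_elem:
  "k \<le> CARD('d::finite) \<Longrightarrow> (y_elem k :: 'd lattice_algebra) = basis_elem id ((\<lambda>_. 0)(k := 1))"
  using y_elem_mult_basis_elem[of k id "\<lambda>_. 0", where 'd = 'd] by (simp add: basis_elem_unit)

lemma basis_index_upd: "(\<sigma>, a) \<in> basis_index d \<Longrightarrow> k \<le> d \<Longrightarrow> (\<sigma>, a(k := c)) \<in> basis_index d"
  by (auto simp: basis_index_def)

lemma unit_in_basis_index: "(id, \<lambda>_. 0) \<in> basis_index d"
  by (simp add: basis_index_def permutes_id)

text \<open>
  The parameter \<open>y_elem k\<close> is itself a basis element, since the identity has no descents.
\<close>

lemma y_elem_bidegree:
  assumes k: "k \<le> CARD('d::finite)"
  shows "(y_elem k :: 'd lattice_algebra) \<in> bidegree_part hypercube sym_weights (1, int k)"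
proof -
  let ?a = "(\<lambda>_. 0)(k := 1 :: nat)"
  have "index_degree CARD('d) (id, ?a) = (1, int k)"
  proof -
    have 1: "(\<Sum>i = 0..CARD('d). ?a i) = 1" using k by (simp add: sum.delta)
    have 2: "(\<Sum>i = 0..CARD('d). ?a i * i) = k"
      using k by (subst sum.remove[of _ k]) (auto intro!: sum.neutral)
    show ?thesis
      using 1 2 sum_slots[of "\<lambda>i. i" "CARD('d)" id ?a]
      by (simp add: index_degree_def card_slots tail_sum_def descent_positions_id del: of_nat_sum)
  qed
  then have "basis_vector (id, ?a) \<in> monoid_algebra.span (basis_vector ` {j \<in> basis_index CARD('d).
      index_degree CARD('d) j = (1, int k)} :: 'd lattice_algebra set)"
    using basis_index_upd[OF unit_in_basis_index k, of 1]
    by (intro monoid_algebra.span_base imageI) simp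
  then show ?thesis
    unfolding span_basis_bidegree by (simp add: y_elem_eq_basis_elem[OF k])
qed

lemma y_elem_carrier: "k \<le> CARD('d::finite) \<Longrightarrow> (y_elem k :: 'd lattice_algebra) \<in> carrier cube_ring"
  using y_elem_bidegree by (auto simp: bidegree_part_def)

lemma basis_vector_carrier: "j \<in> basis_index CARD('d::finite) \<Longrightarrow> (basis_vector j :: 'd lattice_algebra) \<in> carrier cube_ring"
  unfolding span_basis[symmetric] by (intro monoid_algebra.span_base imageI)

lemma mult_in_span:
  fixes x :: "'k::comm_monoid_add \<Rightarrow>\<^sub>0 'c::field"
  assumes "f \<in> monoid_algebra.span S" "\<And>s. s \<in> S \<Longrightarrow> x * s \<in> monoid_algebra.span T"
  shows "x * f \<in> monoid_algebra.span T"
  using assms(1)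
proof (induction rule: monoid_algebra.span_induct_alt)
  case base
  show ?case by (simp add: monoid_algebra.span_zero)
next
  case (step c s g)
  have "x * (Poly_Mapping.single 0 c * s + g) = Poly_Mapping.single 0 c * (x * s) + x * g"
    by (simp add: algebra_simps)
  then show ?case
    using step assms(2) by (auto intro!: monoid_algebra.span_add monoid_algebra.span_scale)
qed

text \<open>
  The indices of the basis elements that have one of the first \<open>k\<close> parameters as an explicit factor.
\<close>

definition divisible_index :: "nat \<Rightarrow> nat \<Rightarrow> ((nat \<Rightarrow> nat) \<times> (nat \<Rightarrow> nat)) set" where
  "divisible_index d k = {(\<sigma>, a) \<in> basis_index d. \<exists>i<k. a i \<noteq> 0}"

lemma divisible_index_subset: "divisible_index d k \<subseteq> basis_index d"
  by (auto simp: divisible_index_def)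

text \<open>
  The span is closed under multiplication by any \<open>x\<close>: a spanning element is \<open>y_elem i * b\<close> with \<open>i < k\<close>, and
  expanding \<open>x * b\<close> in the basis and multiplying by \<open>y_elem i\<close> raises the exponent of \<open>y_elem i\<close> in every term.
\<close>

lemma genideal_y_elem:
  assumes k: "k \<le> CARD('d::finite) + 1"
  shows "genideal cube_ring (y_elem ` {..<k} :: 'd lattice_algebra set)
    = monoid_algebra.span (basis_vector ` divisible_index CARD('d) k)" (is "_ = ?W")
proof
  have Wcarr: "?W \<subseteq> carrier cube_ring"
    unfolding span_basis[symmetric] by (intro monoid_algebra.span_mono image_mono divisible_index_subset)
  have factor: "\<exists>i<k. \<exists>t\<in>basis_index CARD('d). basis_vector s = y_elem i * (basis_vector t :: 'd lattice_algebra)"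
    if "s \<in> divisible_index CARD('d) k" for s
  proof -
    obtain \<sigma> a i where s: "s = (\<sigma>, a)" "(\<sigma>, a) \<in> basis_index CARD('d)" "i < k" "a i \<noteq> 0"
      using \<open>s \<in> _\<close> by (auto simp: divisible_index_def)
    have i: "i \<le> CARD('d)" using s k by simp
    have "a = (a(i := a i - 1))(i := Suc ((a(i := a i - 1)) i))" using s by auto
    then have "basis_elem \<sigma> a = y_elem i * (basis_elem \<sigma> (a(i := a i - 1)) :: 'd lattice_algebra)"
      using y_elem_mult_basis_elem[OF i, of \<sigma> "a(i := a i - 1)"] by metis
    then show ?thesis
      using s(1,3) basis_index_upd[OF s(2) i, of "a i - 1"] by (intro exI[of _ i] conjI bexI) auto
  qed
  have y_mult: "y_elem i * f \<in> ?W" if "i < k" "f \<in> carrier cube_ring" for i and f :: "'d lattice_algebra"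
  proof (rule mult_in_span)
    show "f \<in> monoid_algebra.span (basis_vector ` basis_index CARD('d))" using that by (simp add: span_basis)
    fix s :: "'d lattice_algebra" assume "s \<in> basis_vector ` basis_index CARD('d)"
    then obtain \<sigma> a where s: "(\<sigma>, a) \<in> basis_index CARD('d)" "s = basis_elem \<sigma> a" by auto
    have i: "i \<le> CARD('d)" using that k by simp
    have "(\<sigma>, a(i := Suc (a i))) \<in> divisible_index CARD('d) k"
      using basis_index_upd[OF s(1) i] \<open>i < k\<close> by (auto simp: divisible_index_def)
    then show "y_elem i * s \<in> ?W"
      unfolding s y_elem_mult_basis_elem[OF i]
      by (intro monoid_algebra.span_base) (auto intro!: image_eqI)
  qed
  have mult: "x * f \<in> ?W" if "x \<in> carrier cube_ring" "f \<in> ?W" for x f :: "'d lattice_algebra"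
  proof (rule mult_in_span[OF that(2)])
    fix v :: "'d lattice_algebra" assume "v \<in> basis_vector ` divisible_index CARD('d) k"
    then obtain i t where it: "i < k" "t \<in> basis_index CARD('d)" "v = y_elem i * (basis_vector t :: 'd lattice_algebra)"
      using factor by blast
    have "x * basis_vector t \<in> carrier cube_ring"
      using cube_ring.m_closed[OF that(1) basis_vector_carrier[OF it(2)]] by simp
    from y_mult[OF it(1) this] show "x * v \<in> ?W" by (simp add: it(3) mult.left_commute)
  qed
  have "ideal ?W cube_ring"
  proof (rule idealI[OF cube_ring.ring_axioms])
    show "subgroup ?W (add_monoid cube_ring)"
    proof (rule cube_ring.add.subgroupI[OF Wcarr])
      show "?W \<noteq> {}" using monoid_algebra.span_zero by blast
      show "\<ominus>\<^bsub>cube_ring\<^esub> f \<in> ?W" if "f \<in> ?W" for f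
        using that Wcarr by (simp add: cube_ring_uminus subset_iff monoid_algebra.span_neg)
      show "f \<oplus>\<^bsub>cube_ring\<^esub> g \<in> ?W" if "f \<in> ?W" "g \<in> ?W" for f g
        using that by (simp add: monoid_algebra.span_add)
    qed
    show "x \<otimes>\<^bsub>cube_ring\<^esub> f \<in> ?W" "f \<otimes>\<^bsub>cube_ring\<^esub> x \<in> ?W" if "f \<in> ?W" "x \<in> carrier cube_ring" for f x
      using mult[OF that(2,1)] by (simp_all add: mult.commute)
  qed
  moreover have "y_elem ` {..<k} \<subseteq> ?W"
  proof
    fix y :: "'d lattice_algebra" assume "y \<in> y_elem ` {..<k}"
    then obtain i where i: "i < k" "y = y_elem i" by blast
    have "(1 :: 'd lattice_algebra) \<in> carrier cube_ring" using cube_ring.one_closed by simp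
    from y_mult[OF i(1) this] show "y \<in> ?W" by (simp add: i)
  qed
  ultimately show "genideal cube_ring (y_elem ` {..<k}) \<subseteq> ?W"
    by (rule cube_ring.genideal_minimal)
  have ysub: "y_elem ` {..<k} \<subseteq> carrier (cube_ring :: 'd lattice_algebra ring)"
    using y_elem_carrier[where 'd = 'd] k by auto
  interpret I: ideal "genideal cube_ring (y_elem ` {..<k} :: 'd lattice_algebra set)" cube_ring
    by (rule cube_ring.genideal_ideal[OF ysub])
  show "?W \<subseteq> genideal cube_ring (y_elem ` {..<k})"
  proof
    fix f :: "'d lattice_algebra" assume "f \<in> ?W"
    then show "f \<in> genideal cube_ring (y_elem ` {..<k})"
    proof (induction rule: monoid_algebra.span_induct_alt)
      case base
      show ?case using I.zero_closed by simp
    next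
      case (step c v g)
      then obtain i t where it: "i < k" "t \<in> basis_index CARD('d)" "v = y_elem i * (basis_vector t :: 'd lattice_algebra)"
        using factor by blast
      have "y_elem i \<in> genideal cube_ring (y_elem ` {..<k} :: 'd lattice_algebra set)"
        using cube_ring.genideal_self[OF ysub] it(1) by blast
      moreover have "Poly_Mapping.single 0 c * (basis_vector t :: 'd lattice_algebra) \<in> carrier cube_ring"
        using cube_ring.m_closed[OF single_0_in_carrier[of c] basis_vector_carrier[OF it(2)]] by simp
      ultimately have "Poly_Mapping.single 0 c * v \<in> genideal cube_ring (y_elem ` {..<k})"
        using I.I_l_closed by (fastforce simp: it(3) mult.left_commute mult.commute)
      then show ?case using I.a_closed step by simp
    qed
  qed
qed

lemma set_take_y_list:
  "k \<le> CARD('d) + 1 \<Longrightarrow> set (take k (y_list :: 'd::finite lattice_algebra list)) = y_elem ` {..<k}"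
  by (simp add: y_list_def take_map take_upt lessThan_atLeast0 del: upt_Suc)

lemma set_y_list: "set (y_list :: 'd::finite lattice_algebra list) = y_elem ` {..<CARD('d) + 1}"
  by (auto simp: y_list_def lessThan_atLeast0 simp del: upt_Suc)

lemma coeff_y_elem_mult:
  assumes "k \<le> CARD('d::finite)" "(\<sigma>, a) \<in> basis_index CARD('d)"
    and f: "(f :: 'd lattice_algebra) \<in> carrier cube_ring"
  shows "cube.coeff (y_elem k * f) (\<sigma>, a(k := Suc (a k))) = cube.coeff f (\<sigma>, a)"
proof -
  define a' where "a' = a(k := Suc (a k))"
  have a': "(\<sigma>, a') \<in> basis_index CARD('d)"
    using basis_index_upd[OF assms(2,1)] by (simp add: a'_def)
  have yk: "(y_elem k :: 'd lattice_algebra) \<in> carrier cube_ring" using y_elem_carrier assms(1) .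
  have "f \<in> monoid_algebra.span (basis_vector ` basis_index CARD('d))" using f by (simp add: span_basis)
  then have "f \<in> carrier cube_ring \<and>
      cube.coeff (y_elem k * f) (\<sigma>, a') = cube.coeff f (\<sigma>, a)"
  proof (induction rule: monoid_algebra.span_induct_alt)
    case base
    show ?case using cube_ring.zero_closed by simp
  next
    case (step c v g)
    then obtain \<tau> b where v: "(\<tau>, b) \<in> basis_index CARD('d)" "v = basis_elem \<tau> b" by auto
    have yv: "y_elem k * v = basis_vector (\<tau>, b(k := Suc (b k)))"
      by (simp add: v y_elem_mult_basis_elem[OF assms(1)])
    have carr: "v \<in> carrier cube_ring" "y_elem k * v \<in> carrier cube_ring" "y_elem k * g \<in> carrier cube_ring"
      "Poly_Mapping.single 0 c * v \<in> carrier cube_ring"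
      "Poly_Mapping.single 0 c * (y_elem k * v) \<in> carrier cube_ring"
      using basis_vector_carrier[OF v(1)] v(2) basis_vector_carrier[OF basis_index_upd[OF v(1) assms(1)]] step yv
        cube_ring.m_closed[OF yk, of g] cube_ring.m_closed[OF single_0_in_carrier[of c], of v]
        cube_ring.m_closed[OF single_0_in_carrier[of c], of "y_elem k * v"]
      by simp_all
    have "b(k := Suc (b k)) = a' \<longleftrightarrow> b = a"
      unfolding a'_def by (metis fun_upd_triv fun_upd_upd fun_upd_same nat.inject)
    then have "cube.coeff (y_elem k * v) (\<sigma>, a') = cube.coeff v (\<sigma>, a)"
      unfolding yv unfolding v(2) using cube.coeff_basis[of "(\<tau>, b)" "(\<sigma>, a)", where 'd = 'd]
        cube.coeff_basis[of "(\<tau>, b(k := Suc (b k)))" "(\<sigma>, a')", where 'd = 'd]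
        basis_index_upd[OF v(1) assms(1)] a' v(1) assms(2)
      by simp
    moreover have "y_elem k * (Poly_Mapping.single 0 c * v + g)
        = Poly_Mapping.single 0 c * (y_elem k * v) + y_elem k * g"
      by (simp add: algebra_simps)
    moreover have "Poly_Mapping.single 0 c * v + g \<in> carrier cube_ring"
      using cube_ring.a_closed[OF carr(4), of g] step by simp
    ultimately show ?case
      using step carr by (simp add: cube.coeff_add cube.coeff_scale span_basis)
  qed
  then show ?thesis by (simp add: a'_def)
qed

lemma one_notin_span_divisible:
  "1 \<notin> (monoid_algebra.span (basis_vector ` divisible_index CARD('d) k) :: 'd::finite lattice_algebra set)"
proof
  let ?u = "(id, \<lambda>_. 0) :: (nat \<Rightarrow> nat) \<times> (nat \<Rightarrow> nat)"
  assume "1 \<in> (monoid_algebra.span (basis_vector ` divisible_index CARD('d) k) :: 'd lattice_algebra set)"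
  moreover have "?u \<in> basis_index CARD('d) - divisible_index CARD('d) k"
    by (simp add: unit_in_basis_index divisible_index_def)
  ultimately have "cube.coeff (1 :: 'd lattice_algebra) ?u = 0"
    using cube.in_span_subfamily_iff[OF divisible_index_subset] by blast
  moreover have "cube.coeff (1 :: 'd lattice_algebra) ?u = 1"
    using cube.coeff_basis[OF unit_in_basis_index unit_in_basis_index, where 'd = 'd]
    by (simp add: basis_elem_unit)
  ultimately show False by simp
qed

lemma rcos_eq_iff:
  assumes "ideal I (cube_ring :: 'd::finite lattice_algebra ring)"
    and "f \<in> carrier cube_ring" "g \<in> carrier cube_ring"
  shows "I +>\<^bsub>cube_ring\<^esub> f = I +>\<^bsub>cube_ring\<^esub> g \<longleftrightarrow> f - g \<in> I"
  using cube_ring.quotient_eq_iff_same_a_r_cos[OF assms] by (simp add: cube_ring_minus assms(2,3))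

text \<open>
  Multiplication by \<open>y_elem k\<close> shifts coordinates from \<open>(\<sigma>, a)\<close> to \<open>(\<sigma>, a(k := Suc (a k)))\<close>, which changes no
  exponent below \<open>k\<close>. So if \<open>y_elem k * f\<close> has its coordinates in \<open>divisible_index d k\<close>, so has \<open>f\<close>.
\<close>

lemma regular_sequence_y_list:
  "regular_sequence cube_ring (y_list :: 'd::finite lattice_algebra list)"
  unfolding regular_sequence_def Let_def
proof (intro conjI allI impI ballI)
  show "set (y_list :: 'd lattice_algebra list) \<subseteq> carrier cube_ring"
    using y_elem_carrier[where 'd = 'd] by (auto simp: set_y_list)
  show "genideal cube_ring (set y_list) \<noteq> (carrier cube_ring :: 'd lattice_algebra set)"
    using one_notin_span_divisible cube_ring.one_closed
    by (auto simp: set_y_list genideal_y_elem)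
  fix k and z :: "'d lattice_algebra set"
  assume "k < length (y_list :: 'd lattice_algebra list)"
  then have k: "k \<le> CARD('d)" by (simp add: y_list_def)
  then have nth: "y_list ! k = (y_elem k :: 'd lattice_algebra)"
    by (simp add: y_list_def del: upt_Suc)
  define I where "I = genideal cube_ring (set (take k y_list) :: 'd lattice_algebra set)"
  have I: "I = monoid_algebra.span (basis_vector ` divisible_index CARD('d) k)"
    using k genideal_y_elem[of k, where 'd = 'd] by (simp add: I_def set_take_y_list)
  have idl: "ideal I cube_ring"
    unfolding I_def using k y_elem_carrier[where 'd = 'd] by (intro cube_ring.genideal_ideal) (auto simp: set_take_y_list)
  interpret I: ideal I cube_ring by (rule idl)
  have mem: "I +>\<^bsub>cube_ring\<^esub> f = I \<longleftrightarrow> f \<in> I" if "f \<in> carrier cube_ring" for f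
    using rcos_eq_iff[OF idl that cube_ring.zero_closed] I.a_rcos_const[OF I.zero_closed] by simp
  assume z: "z \<in> carrier (cube_ring Quot genideal cube_ring (set (take k y_list)))"
    and zero: "(genideal cube_ring (set (take k y_list)) +>\<^bsub>cube_ring\<^esub> y_list ! k)
       \<otimes>\<^bsub>cube_ring Quot genideal cube_ring (set (take k y_list))\<^esub> z
      = \<zero>\<^bsub>cube_ring Quot genideal cube_ring (set (take k y_list))\<^esub>"
  obtain f where f: "f \<in> carrier cube_ring" "z = I +>\<^bsub>cube_ring\<^esub> f"
    using z by (auto simp: I_def[symmetric] FactRing_def A_RCOSETS_def')
  have yk: "(y_elem k :: 'd lattice_algebra) \<in> carrier cube_ring" by (rule y_elem_carrier[OF k])
  have yf: "y_elem k * f \<in> carrier cube_ring" using cube_ring.m_closed[OF yk f(1)] by simp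
  have "I +>\<^bsub>cube_ring\<^esub> (y_elem k * f) = I"
    using zero I.rcoset_mult_add[OF yk f(1)] by (simp add: nth I_def[symmetric] FactRing_def f(2))
  then have yfI: "y_elem k * f \<in> I" using mem[OF yf] by simp
  have "cube.coeff f j = 0" if j: "j \<in> basis_index CARD('d) - divisible_index CARD('d) k" for j
  proof -
    obtain \<sigma> a where ja: "j = (\<sigma>, a)" by (cases j)
    have "(\<sigma>, a(k := Suc (a k))) \<in> basis_index CARD('d) - divisible_index CARD('d) k"
      using j basis_index_upd[of \<sigma> a "CARD('d)" k] k by (auto simp: ja divisible_index_def)
    then have "cube.coeff (y_elem k * f) (\<sigma>, a(k := Suc (a k))) = 0"
      using yfI cube.in_span_subfamily_iff[OF divisible_index_subset] unfolding I by blast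
    then show ?thesis using coeff_y_elem_mult[OF k _ f(1), of \<sigma> a] j by (simp add: ja)
  qed
  then have "f \<in> I"
    unfolding I by (subst cube.in_span_subfamily_iff[OF divisible_index_subset]) (auto simp: span_basis f(1))
  then show "z = \<zero>\<^bsub>cube_ring Quot genideal cube_ring (set (take k y_list))\<^esub>"
    using mem[OF f(1)] f(2) by (simp add: I_def[symmetric] FactRing_def)
qed

section \<open>The quotient by the parameters\<close>

definition descent_index :: "nat \<Rightarrow> ((nat \<Rightarrow> nat) \<times> (nat \<Rightarrow> nat)) set" where
  "descent_index d = {(\<sigma>, a). \<sigma> permutes {1..d} \<and> a = (\<lambda>_. 0)}"

lemma descent_index_eq: "descent_index d = basis_index d - divisible_index d (d + 1)"
proof -
  have "a = (\<lambda>_. 0)" if "\<forall>i>d. a i = 0" "\<forall>i<Suc d. a i = 0" for a :: "nat \<Rightarrow> nat"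
    using that by (intro ext) (metis less_Suc_eq_le not_less)
  then show ?thesis
    by (fastforce simp: descent_index_def basis_index_def divisible_index_def)
qed

lemma descent_index_subset: "descent_index d \<subseteq> basis_index d"
  by (auto simp: descent_index_eq)

lemma finite_descent_index: "finite (descent_index d)"
proof -
  have "descent_index d = (\<lambda>\<sigma>. (\<sigma>, \<lambda>_. 0)) ` {\<sigma>. \<sigma> permutes {1..d}}"
    by (auto simp: descent_index_def)
  then show ?thesis by (simp add: finite_permutations)
qed

lemma index_degree_descent: "index_degree d (\<sigma>, \<lambda>_. 0) = (desc d \<sigma>, int (maj d \<sigma>))"
proof -
  have D: "{0..d} \<inter> descent_positions d \<sigma> = descent_positions d \<sigma>"
    using descent_positions_subset[of d \<sigma>] by fastforce
  have "(\<Sum>i\<in>{0..d}. of_bool (i \<in> descent_positions d \<sigma>) * h i) = (\<Sum>i\<in>descent_positions d \<sigma>. h i)"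
    for h :: "nat \<Rightarrow> nat"
    by (simp add: D)
  from this[of "\<lambda>_. 1"] this[of "\<lambda>i. i"] show ?thesis
    using sum_slots[of "\<lambda>i. i" d \<sigma> "\<lambda>_. 0"]
    by (simp add: index_degree_def card_slots tail_sum_def desc_def maj_def del: of_nat_sum)
qed

lemma y_ideal_eq:
  "y_ideal = (monoid_algebra.span (basis_vector ` divisible_index CARD('d) (CARD('d) + 1)) :: 'd::finite lattice_algebra set)"
  unfolding y_ideal_def set_y_list by (rule genideal_y_elem) simp

lemma ideal_y_ideal: "ideal y_ideal (cube_ring :: 'd::finite lattice_algebra ring)"
  unfolding y_ideal_def set_y_list
  using y_elem_carrier[where 'd = 'd] by (intro cube_ring.genideal_ideal) auto

abbreviation coset :: "'d::finite lattice_algebra \<Rightarrow> 'd lattice_algebra set" where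
  "coset f \<equiv> y_ideal +>\<^bsub>cube_ring\<^esub> f"

interpretation cube_quotient: cring "cube_quotient :: 'd::finite lattice_algebra set ring"
  unfolding cube_quotient_def by (rule ideal.quotient_is_cring[OF ideal_y_ideal cring_cube_ring])

lemma coset_hom: "ring_hom_cring (cube_ring :: 'd::finite lattice_algebra ring) cube_quotient coset"
  unfolding cube_quotient_def by (rule ideal.rcos_ring_hom_cring[OF ideal_y_ideal cring_cube_ring])

lemma coset_ring_hom: "coset \<in> ring_hom (cube_ring :: 'd::finite lattice_algebra ring) cube_quotient"
  unfolding cube_quotient_def by (rule ideal.rcos_ring_hom[OF ideal_y_ideal])

lemma coset_eq_iff:
  "f \<in> carrier cube_ring \<Longrightarrow> g \<in> carrier cube_ring \<Longrightarrow> coset f = coset g \<longleftrightarrow> f - g \<in> y_ideal"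
  by (rule rcos_eq_iff[OF ideal_y_ideal])

lemma coset_add: "f \<in> carrier cube_ring \<Longrightarrow> g \<in> carrier cube_ring \<Longrightarrow>
    coset (f + g) = coset f \<oplus>\<^bsub>cube_quotient\<^esub> coset g"
  using ring_hom_add[OF coset_ring_hom, of f g] by simp

lemma coset_mult: "f \<in> carrier cube_ring \<Longrightarrow> g \<in> carrier cube_ring \<Longrightarrow>
    coset (f * g) = coset f \<otimes>\<^bsub>cube_quotient\<^esub> coset g"
  using ring_hom_mult[OF coset_ring_hom, of f g] by simp

lemma coset_zero: "coset (0 :: 'd::finite lattice_algebra) = \<zero>\<^bsub>cube_quotient\<^esub>"
  using ring_hom_cring.hom_zero[OF coset_hom] by simp

lemma carrier_cube_quotient: "carrier cube_quotient = coset ` carrier cube_ring"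
  by (auto simp: cube_quotient_def FactRing_def A_RCOSETS_def')

lemma span_subset_carrier:
  "S \<subseteq> basis_index CARD('d) \<Longrightarrow>
    monoid_algebra.span (basis_vector ` S) \<subseteq> carrier (cube_ring :: 'd::finite lattice_algebra ring)"
  unfolding span_basis[symmetric] by (intro monoid_algebra.span_mono image_mono)

text \<open>
  Every basis element other than a descent monomial lies in the ideal of the parameters.
\<close>

lemma coset_span_eq:
  assumes "S \<subseteq> basis_index CARD('d::finite)"
  shows "coset ` monoid_algebra.span (basis_vector ` S)
    = coset ` (monoid_algebra.span (basis_vector ` (S \<inter> descent_index CARD('d))) :: 'd lattice_algebra set)"
    (is "coset ` ?A = coset ` ?B")
proof (intro equalityI subsetI)
  fix X assume "X \<in> coset ` ?A"
  then obtain f where f: "f \<in> ?A" "X = coset f" by blast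
  have "S \<subseteq> (S \<inter> descent_index CARD('d)) \<union> divisible_index CARD('d) (CARD('d) + 1)"
    using assms by (auto simp: descent_index_eq)
  then have "?A \<subseteq> monoid_algebra.span (basis_vector ` (S \<inter> descent_index CARD('d))
      \<union> basis_vector ` divisible_index CARD('d) (CARD('d) + 1))"
    by (intro monoid_algebra.span_mono) blast
  then obtain g h where gh: "f = g + h" "g \<in> ?B" "h \<in> y_ideal"
    using f(1) unfolding monoid_algebra.span_Un y_ideal_eq by blast
  have "g \<in> carrier cube_ring"
    using gh(2) span_subset_carrier[of "S \<inter> descent_index CARD('d)", where 'd = 'd] descent_index_subset by blast
  moreover have "f \<in> carrier cube_ring" using f(1) span_subset_carrier[OF assms] by blast
  ultimately have "coset f = coset g" using coset_eq_iff[of f g] gh by simp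
  then show "X \<in> coset ` ?B" using f gh by blast
next
  fix X assume "X \<in> coset ` ?B"
  moreover have "?B \<subseteq> ?A" by (intro monoid_algebra.span_mono image_mono) auto
  ultimately show "X \<in> coset ` ?A" by blast
qed

lemma quotient_part_eq:
  "quotient_part p = coset ` (monoid_algebra.span
     (basis_vector ` {j \<in> descent_index CARD('d). index_degree CARD('d) j = p}) :: 'd::finite lattice_algebra set)"
proof -
  have "{j \<in> basis_index CARD('d). index_degree CARD('d) j = p} \<inter> descent_index CARD('d)
      = {j \<in> descent_index CARD('d). index_degree CARD('d) j = p}"
    using descent_index_subset by blast
  then show ?thesis
    unfolding quotient_part_def span_basis_bidegree[symmetric]
    using coset_span_eq[of "{j \<in> basis_index CARD('d). index_degree CARD('d) j = p}", where 'd = 'd] by simp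
qed

lemma carrier_cube_quotient_eq:
  "carrier cube_quotient = coset ` (monoid_algebra.span (basis_vector ` descent_index CARD('d)) :: 'd::finite lattice_algebra set)"
proof -
  have "basis_index CARD('d) \<inter> descent_index CARD('d) = descent_index CARD('d)"
    using descent_index_subset by blast
  then show ?thesis
    unfolding carrier_cube_quotient span_basis[symmetric]
    using coset_span_eq[of "basis_index CARD('d)", where 'd = 'd] by simp
qed

lemma coeff_y_ideal:
  assumes "f \<in> y_ideal" "j \<in> descent_index CARD('d::finite)"
  shows "cube.coeff (f :: 'd lattice_algebra) j = 0"
  using assms cube.in_span_subfamily_iff[OF divisible_index_subset]
  unfolding y_ideal_eq descent_index_eq by blast

lemma subfield_quotient_scalars:
  "subfield quotient_scalars (cube_quotient :: 'd::finite lattice_algebra set ring)"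
proof -
  have "\<one>\<^bsub>cube_quotient\<^esub> \<noteq> (\<zero>\<^bsub>cube_quotient\<^esub> :: 'd lattice_algebra set)"
  proof
    assume "\<one>\<^bsub>cube_quotient\<^esub> = (\<zero>\<^bsub>cube_quotient\<^esub> :: 'd lattice_algebra set)"
    then have "coset (1 :: 'd lattice_algebra) = coset 0"
      using ring_hom_one[OF coset_ring_hom[where 'd = 'd]] coset_zero[where 'd = 'd] by simp
    moreover have "(1 :: 'd lattice_algebra) \<in> carrier cube_ring" "(0 :: 'd lattice_algebra) \<in> carrier cube_ring"
      using cube_ring.one_closed cube_ring.zero_closed by simp_all
    ultimately have "1 \<in> (y_ideal :: 'd lattice_algebra set)" using coset_eq_iff by force
    then show False using one_notin_span_divisible unfolding y_ideal_eq by blast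
  qed
  then show ?thesis
    unfolding quotient_scalars_def
    using ring_hom_ring.img_is_subfield(2)[OF
        ideal.rcos_ring_hom_ring[OF ideal_y_ideal, folded cube_quotient_def]
        subfield_scalars[OF convex_hypercube hypercube_nonempty]] by simp
qed

text \<open>
  A coordinate at a descent monomial vanishes on the ideal, so it detects that the class of a
  further descent monomial is not in the span of the previous ones.
\<close>

lemma dimension_coset_span:
  assumes S: "S \<subseteq> descent_index CARD('d::finite)"
  shows "ring.dimension cube_quotient (card S) quotient_scalars
    (coset ` (monoid_algebra.span (basis_vector ` S) :: 'd lattice_algebra set))"
proof -
  have "finite S" using S finite_descent_index finite_subset by blast
  then show ?thesis using S
  proof (induction S rule: finite_induct)
    case empty
    then show ?case using cube_quotient.zero_dim by (simp add: coset_zero)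
  next
    case (insert s S)
    have s: "s \<in> descent_index CARD('d)" "s \<in> basis_index CARD('d)"
      and SJ: "S \<subseteq> basis_index CARD('d)" "insert s S \<subseteq> basis_index CARD('d)"
      using insert.prems descent_index_subset by blast+
    have carr: "basis_vector s \<in> carrier (cube_ring :: 'd lattice_algebra ring)" by (rule basis_vector_carrier[OF s(2)])
    let ?E = "coset ` (monoid_algebra.span (basis_vector ` S) :: 'd lattice_algebra set)"
    have notin: "coset (basis_vector s :: 'd lattice_algebra) \<notin> ?E"
    proof
      assume "coset (basis_vector s :: 'd lattice_algebra) \<in> ?E"
      then obtain g :: "'d lattice_algebra" where g: "g \<in> monoid_algebra.span (basis_vector ` S)" "coset (basis_vector s) = coset g"
        by blast
      have gc: "g \<in> carrier cube_ring" using g(1) span_subset_carrier[OF SJ(1)] by blast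
      have "cube.coeff (basis_vector s - g) s = 0"
        using coeff_y_ideal[OF _ s(1)] coset_eq_iff[OF carr gc] g(2) by blast
      moreover have "cube.coeff g s = 0"
        using g(1) insert.hyps s(2) unfolding cube.in_span_subfamily_iff[OF SJ(1)] by blast
      moreover have "cube.coeff (basis_vector s :: 'd lattice_algebra) s = 1"
        using cube.coeff_basis[OF s(2) s(2)] by simp
      ultimately show False using carr gc by (simp add: cube.coeff_diff span_basis)
    qed
    have "cube_quotient.line_extension quotient_scalars (coset (basis_vector s)) ?E
        = coset ` (monoid_algebra.span (basis_vector ` insert s S) :: 'd lattice_algebra set)"
    proof (intro equalityI subsetI)
      fix X assume "X \<in> cube_quotient.line_extension quotient_scalars (coset (basis_vector s)) ?E"
      then obtain c f where cf: "f \<in> monoid_algebra.span (basis_vector ` S)"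
        "X = coset (Poly_Mapping.single 0 c) \<otimes>\<^bsub>cube_quotient\<^esub> coset (basis_vector s) \<oplus>\<^bsub>cube_quotient\<^esub> coset f"
        unfolding cube_quotient.line_extension_mem_iff quotient_scalars_def scalars_def by blast
      have fc: "f \<in> carrier cube_ring" using cf(1) span_subset_carrier[OF SJ(1)] by blast
      have cs: "Poly_Mapping.single 0 c * basis_vector s \<in> carrier (cube_ring :: 'd lattice_algebra ring)"
        using cube_ring.m_closed[OF single_0_in_carrier carr] by simp
      have "X = coset (Poly_Mapping.single 0 c * basis_vector s + f)"
        using cf(2) coset_add[OF cs fc] coset_mult[OF single_0_in_carrier carr] by simp
      moreover have "Poly_Mapping.single 0 c * basis_vector s + f \<in> monoid_algebra.span (basis_vector ` insert s S)"
      proof (intro monoid_algebra.span_add monoid_algebra.span_scale)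
        show "basis_vector s \<in> monoid_algebra.span (basis_vector ` insert s S)"
          by (intro monoid_algebra.span_base) blast
        show "f \<in> monoid_algebra.span (basis_vector ` insert s S)"
          using monoid_algebra.span_mono[OF image_mono[OF subset_insertI]] cf(1) by (rule subsetD)
      qed
      ultimately show "X \<in> coset ` monoid_algebra.span (basis_vector ` insert s S)" by blast
    next
      fix X assume "X \<in> coset ` (monoid_algebra.span (basis_vector ` insert s S) :: 'd lattice_algebra set)"
      then obtain f :: "'d lattice_algebra" where f: "f \<in> monoid_algebra.span (basis_vector ` insert s S)" "X = coset f"
        by blast
      obtain c where c: "f - Poly_Mapping.single 0 c * basis_vector s \<in> monoid_algebra.span (basis_vector ` S)"
        using f(1) by (auto simp: monoid_algebra.span_insert)
      define g where "g = f - Poly_Mapping.single 0 c * basis_vector s"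
      have gc: "g \<in> carrier cube_ring" using c span_subset_carrier[OF SJ(1)] by (auto simp: g_def)
      have cs: "Poly_Mapping.single 0 c * basis_vector s \<in> carrier (cube_ring :: 'd lattice_algebra ring)"
        using cube_ring.m_closed[OF single_0_in_carrier carr] by simp
      have "X = coset (Poly_Mapping.single 0 c) \<otimes>\<^bsub>cube_quotient\<^esub> coset (basis_vector s) \<oplus>\<^bsub>cube_quotient\<^esub> coset g"
        using coset_add[OF cs gc] coset_mult[OF single_0_in_carrier carr] by (simp add: f(2) g_def)
      then show "X \<in> cube_quotient.line_extension quotient_scalars (coset (basis_vector s)) ?E"
        using c unfolding cube_quotient.line_extension_mem_iff quotient_scalars_def scalars_def g_def by blast
    qed
    moreover have "cube_quotient.dimension (Suc (card S)) quotient_scalars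
        (cube_quotient.line_extension quotient_scalars (coset (basis_vector s)) ?E)"
      using insert notin carr by (intro cube_quotient.Suc_dim ring_hom_closed[OF coset_ring_hom]) auto
    ultimately show ?case using insert.hyps by simp
  qed
qed

lemma finsum_cube_ring:
  "finite P \<Longrightarrow> (\<And>p. p \<in> P \<Longrightarrow> g p \<in> carrier cube_ring) \<Longrightarrow> (\<Oplus>\<^bsub>cube_ring\<^esub>p\<in>P. g p) = (\<Sum>p\<in>P. g p)"
  by (induction P rule: finite_induct) (auto simp: Pi_def)

lemma coset_sum:
  assumes "finite P" "\<And>p. p \<in> P \<Longrightarrow> g p \<in> carrier cube_ring"
  shows "coset (\<Sum>p\<in>P. g p) = (\<Oplus>\<^bsub>cube_quotient\<^esub>p\<in>P. coset (g p))"
  using ring_hom_cring.hom_finsum[OF coset_hom, of g P] assms finsum_cube_ring[OF assms] by (simp add: Pi_def comp_def)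

section \<open>The bigrading and the Hilbert series\<close>

lemma quotient_dimension:
  "ring.finite_dimension cube_quotient quotient_scalars (carrier cube_quotient :: 'd::finite lattice_algebra set set)"
  unfolding carrier_cube_quotient_eq
  by (rule cube_quotient.finite_dimensionI[OF dimension_coset_span]) simp

lemma dim_quotient_part:
  "ring.dim cube_quotient quotient_scalars (quotient_part p :: 'd::finite lattice_algebra set set)
    = card {j \<in> descent_index CARD('d). index_degree CARD('d) j = p}"
proof -
  have "{j \<in> descent_index CARD('d). index_degree CARD('d) j = p} \<subseteq> descent_index CARD('d)" by blast
  from cube_quotient.dimI[OF subfield_quotient_scalars dimension_coset_span[OF this]]
  show ?thesis unfolding over_def quotient_part_eq .
qed

text \<open>
  Lift both families to combinations of descent monomials. The difference of the sums lies in the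
  ideal, hence has zero coordinates at all descent monomials; as different bidegrees involve different
  descent monomials, the lifts agree degree by degree.
\<close>

lemma quotient_part_sum_unique:
  assumes "finite P"
    and c: "\<And>p. c p \<in> (quotient_part p :: 'd::finite lattice_algebra set set)"
    and c': "\<And>p. c' p \<in> quotient_part p"
    and eq: "(\<Oplus>\<^bsub>cube_quotient\<^esub>p\<in>P. c p) = (\<Oplus>\<^bsub>cube_quotient\<^esub>p\<in>P. c' p)"
    and p: "p \<in> P"
  shows "c p = c' p"
proof -
  let ?S = "\<lambda>p. {j \<in> descent_index CARD('d). index_degree CARD('d) j = p}"
  have SJ: "?S q \<subseteq> basis_index CARD('d)" for q using descent_index_subset by blast
  have "\<forall>q. \<exists>f :: 'd lattice_algebra. f \<in> monoid_algebra.span (basis_vector ` ?S q) \<and> c q = coset f"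
    using c unfolding quotient_part_eq by blast
  from choice[OF this] obtain g :: "nat \<times> int \<Rightarrow> 'd lattice_algebra"
    where g: "\<And>q. g q \<in> monoid_algebra.span (basis_vector ` ?S q)" "\<And>q. c q = coset (g q)" by blast
  have "\<forall>q. \<exists>f :: 'd lattice_algebra. f \<in> monoid_algebra.span (basis_vector ` ?S q) \<and> c' q = coset f"
    using c' unfolding quotient_part_eq by blast
  from choice[OF this] obtain g' :: "nat \<times> int \<Rightarrow> 'd lattice_algebra"
    where g': "\<And>q. g' q \<in> monoid_algebra.span (basis_vector ` ?S q)" "\<And>q. c' q = coset (g' q)" by blast
  have carr: "g q \<in> carrier cube_ring" "g' q \<in> carrier cube_ring" for q
    by (rule subsetD[OF span_subset_carrier[OF SJ] g(1)], rule subsetD[OF span_subset_carrier[OF SJ] g'(1)])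
  have carrsum: "(\<Sum>q\<in>P. g q) \<in> carrier cube_ring" "(\<Sum>q\<in>P. g' q) \<in> carrier cube_ring"
    using carr unfolding span_basis[symmetric] by (auto intro: monoid_algebra.span_sum)
  have "coset (\<Sum>q\<in>P. g q) = coset (\<Sum>q\<in>P. g' q)"
    using eq assms(1) carr by (simp add: coset_sum g(2) g'(2))
  then have "(\<Sum>q\<in>P. g q) - (\<Sum>q\<in>P. g' q) \<in> y_ideal" using coset_eq_iff[OF carrsum] by simp
  then have diff: "(\<Sum>q\<in>P. g q - g' q) \<in> y_ideal" by (simp add: sum_subtractf)
  have dspan: "g q - g' q \<in> monoid_algebra.span (basis_vector ` ?S q)" for q
    using g(1) g'(1) by (rule monoid_algebra.span_diff)
  have dcarr: "g q - g' q \<in> carrier cube_ring" for q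
    by (rule subsetD[OF span_subset_carrier[OF SJ] dspan])
  have zero: "cube.coeff (g p - g' p) j = 0" if j: "j \<in> basis_index CARD('d)" for j
  proof (cases "j \<in> ?S p")
    case False
    then show ?thesis using dspan[of p] j unfolding cube.in_span_subfamily_iff[OF SJ] by blast
  next
    case True
    have "cube.coeff (g q - g' q) j = 0" if "q \<noteq> p" for q
      using dspan[of q] j True that unfolding cube.in_span_subfamily_iff[OF SJ] by auto
    then have "(\<Sum>q\<in>P. cube.coeff (g q - g' q) j) = cube.coeff (g p - g' p) j"
      using assms(1) p by (subst sum.remove[of _ p]) (auto intro: sum.neutral)
    moreover have "cube.coeff (\<Sum>q\<in>P. g q - g' q) j = (\<Sum>q\<in>P. cube.coeff (g q - g' q) j)"
      using dcarr by (intro cube.coeff_sum) (simp add: span_basis)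
    ultimately show ?thesis using coeff_y_ideal[OF diff] True by simp
  qed
  have "g p - g' p \<in> monoid_algebra.span (basis_vector ` {})"
    using zero dcarr by (subst cube.in_span_subfamily_iff) (auto simp: span_basis)
  then have "g p = g' p" by simp
  then show ?thesis by (simp add: g(2) g'(2))
qed

lemma quotient_part_carrier: "(quotient_part p :: 'd::finite lattice_algebra set set) \<subseteq> carrier cube_quotient"
  unfolding quotient_part_def carrier_cube_quotient by (auto simp: bidegree_part_def)

lemma finsum_quotient_superset:
  assumes "finite P" "{p. c p \<noteq> \<zero>\<^bsub>cube_quotient\<^esub>} \<subseteq> P"
    and "\<And>p. c p \<in> (quotient_part p :: 'd::finite lattice_algebra set set)"
  shows "(\<Oplus>\<^bsub>cube_quotient\<^esub>p\<in>{p. c p \<noteq> \<zero>\<^bsub>cube_quotient\<^esub>}. c p) = (\<Oplus>\<^bsub>cube_quotient\<^esub>p\<in>P. c p)"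
proof (rule cube_quotient.add.finprod_mono_neutral_cong_left[OF assms(1,2)])
  show "c \<in> P \<rightarrow> carrier cube_quotient" using assms(3) quotient_part_carrier by blast
qed auto

text \<open>
  Existence of the decomposition comes from grouping the expansion in descent monomials by
  bidegree, uniqueness from \<open>quotient_part_sum_unique\<close>.
\<close>

lemma is_bigrading_quotient:
  "is_bigrading quotient_scalars (cube_quotient :: 'd::finite lattice_algebra set ring) quotient_part"
  unfolding is_bigrading_def
proof (intro conjI allI ballI)
  fix p
  show "subalgebra quotient_scalars (quotient_part p) (cube_quotient :: 'd lattice_algebra set ring)"
    unfolding quotient_part_eq
    by (intro cube_quotient.finite_dimension_imp_subalgebra[OF subfield_quotient_scalars]
        cube_quotient.finite_dimensionI[OF dimension_coset_span]) auto
next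
  fix X :: "'d lattice_algebra set" assume X: "X \<in> carrier cube_quotient"
  let ?J = "descent_index CARD('d)" and ?deg = "index_degree CARD('d)"
  show "\<exists>!c. (\<forall>p. c p \<in> quotient_part p) \<and> finite {p. c p \<noteq> \<zero>\<^bsub>cube_quotient\<^esub>} \<and>
      X = (\<Oplus>\<^bsub>cube_quotient\<^esub>p \<in> {p. c p \<noteq> \<zero>\<^bsub>cube_quotient\<^esub>}. c p)"
  proof (rule ex_ex1I)
    obtain f :: "'d lattice_algebra" where f: "f \<in> monoid_algebra.span (basis_vector ` ?J)" "X = coset f"
      using X unfolding carrier_cube_quotient_eq by blast
    define g :: "nat \<times> int \<Rightarrow> 'd lattice_algebra" where "g p = (\<Sum>j\<in>{j \<in> ?J. ?deg j = p}. Poly_Mapping.single 0 (cube.coeff f j) * basis_vector j)" for p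
    define c where "c p = coset (g p)" for p
    have gspan: "g p \<in> monoid_algebra.span (basis_vector ` {j \<in> ?J. ?deg j = p})" for p
      unfolding g_def
      by (intro monoid_algebra.span_sum monoid_algebra.span_scale monoid_algebra.span_base imageI)
    have gcarr: "g p \<in> carrier cube_ring" for p
    proof -
      have "{j \<in> ?J. ?deg j = p} \<subseteq> basis_index CARD('d)" using descent_index_subset by blast
      from subsetD[OF span_subset_carrier[OF this] gspan[of p]] show ?thesis .
    qed
    have cV: "c p \<in> quotient_part p" for p
      unfolding c_def quotient_part_eq by (intro imageI gspan)
    have supp: "{p. c p \<noteq> \<zero>\<^bsub>cube_quotient\<^esub>} \<subseteq> ?deg ` ?J"
    proof
      fix p assume "p \<in> {p. c p \<noteq> \<zero>\<^bsub>cube_quotient\<^esub>}"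
      then have "g p \<noteq> 0" by (auto simp: c_def coset_zero)
      then have "{j \<in> ?J. ?deg j = p} \<noteq> {}" unfolding g_def by (metis (no_types, lifting) sum.empty)
      then show "p \<in> ?deg ` ?J" by blast
    qed
    have fin: "finite (?deg ` ?J)" by (intro finite_imageI finite_descent_index)
    have "f = (\<Sum>j\<in>?J. Poly_Mapping.single 0 (cube.coeff f j) * basis_vector j)"
      by (rule cube.coeff_sum_eq[OF finite_descent_index descent_index_subset f(1)])
    also have "\<dots> = (\<Sum>p\<in>?deg ` ?J. g p)"
      unfolding g_def by (rule sum.image_gen[OF finite_descent_index])
    finally have "X = coset (\<Sum>p\<in>?deg ` ?J. g p)" using f(2) by simp
    also have "\<dots> = (\<Oplus>\<^bsub>cube_quotient\<^esub>p\<in>?deg ` ?J. c p)"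
      unfolding c_def by (rule coset_sum[OF fin gcarr])
    also have "\<dots> = (\<Oplus>\<^bsub>cube_quotient\<^esub>p \<in> {p. c p \<noteq> \<zero>\<^bsub>cube_quotient\<^esub>}. c p)"
      by (rule finsum_quotient_superset[OF fin supp cV, symmetric])
    finally show "\<exists>c. (\<forall>p. c p \<in> quotient_part p) \<and> finite {p. c p \<noteq> \<zero>\<^bsub>cube_quotient\<^esub>} \<and>
        X = (\<Oplus>\<^bsub>cube_quotient\<^esub>p \<in> {p. c p \<noteq> \<zero>\<^bsub>cube_quotient\<^esub>}. c p)"
      using cV finite_subset[OF supp fin] by blast
  next
    fix c c' :: "nat \<times> int \<Rightarrow> 'd lattice_algebra set"
    assume c: "(\<forall>p. c p \<in> quotient_part p) \<and> finite {p. c p \<noteq> \<zero>\<^bsub>cube_quotient\<^esub>} \<and>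
        X = (\<Oplus>\<^bsub>cube_quotient\<^esub>p \<in> {p. c p \<noteq> \<zero>\<^bsub>cube_quotient\<^esub>}. c p)"
      and c': "(\<forall>p. c' p \<in> quotient_part p) \<and> finite {p. c' p \<noteq> \<zero>\<^bsub>cube_quotient\<^esub>} \<and>
        X = (\<Oplus>\<^bsub>cube_quotient\<^esub>p \<in> {p. c' p \<noteq> \<zero>\<^bsub>cube_quotient\<^esub>}. c' p)"
    define P where "P = {p. c p \<noteq> \<zero>\<^bsub>cube_quotient\<^esub>} \<union> {p. c' p \<noteq> \<zero>\<^bsub>cube_quotient\<^esub>}"
    have fin: "finite P" using c c' by (simp add: P_def)
    have "(\<Oplus>\<^bsub>cube_quotient\<^esub>p\<in>P. c p) = X"
      using finsum_quotient_superset[OF fin, of c] c by (auto simp: P_def)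
    moreover have "(\<Oplus>\<^bsub>cube_quotient\<^esub>p\<in>P. c' p) = X"
      using finsum_quotient_superset[OF fin, of c'] c' by (auto simp: P_def)
    ultimately have "c p = c' p" if "p \<in> P" for p
      using quotient_part_sum_unique[OF fin, of c c' p] c c' that by simp
    then show "c = c'" by (intro ext) (metis (mono_tags, lifting) P_def UnCI mem_Collect_eq)
  qed
qed

lemma card_descent_index:
  "card {j \<in> descent_index d. index_degree d j = (r, k)}
    = card {\<sigma>. \<sigma> permutes {1..d} \<and> desc d \<sigma> = r \<and> int (maj d \<sigma>) = k}"
proof -
  have "{j \<in> descent_index d. index_degree d j = (r, k)}
     = (\<lambda>\<sigma>. (\<sigma>, \<lambda>_. 0)) ` {\<sigma>. \<sigma> permutes {1..d} \<and> desc d \<sigma> = r \<and> int (maj d \<sigma>) = k}"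
    by (auto simp: descent_index_def index_degree_descent)
  then show ?thesis by (simp add: card_image inj_on_def)
qed

lemma refined_eulerian_nth:
  "fps_nth (refined_eulerian d fps_X (fps_const fls_X) :: int fls fps) r
    = (\<Sum>\<sigma> | \<sigma> permutes {1..d}. if desc d \<sigma> = r then fls_X ^ maj d \<sigma> else 0)"
  unfolding refined_eulerian_def fps_sum_nth
  by (intro sum.cong refl) (simp add: fps_const_power fps_X_power_nth)

lemma hilbert_series_quotient:
  "bigraded_hilbert_series quotient_scalars (cube_quotient :: 'd::finite lattice_algebra set ring) quotient_part
    = refined_eulerian CARD('d) fps_X (fps_const fls_X)"
proof (rule fps_ext)
  fix r
  let ?P = "{\<sigma>. \<sigma> permutes {1..CARD('d)}}"
  let ?N = "\<lambda>k. int (card {\<sigma> \<in> ?P. desc CARD('d) \<sigma> = r \<and> int (maj CARD('d) \<sigma>) = k})"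
  have fin: "finite ?P" by (simp add: finite_permutations)
  have N: "?N k = (\<Sum>\<sigma>\<in>?P. if desc CARD('d) \<sigma> = r \<and> int (maj CARD('d) \<sigma>) = k then 1 else 0)" for k
    using fin by (simp add: sum.If_cases Int_def)
  have bdd: "\<forall>\<^sub>\<infinity>n. ?N (- int n) = 0"
    unfolding MOST_nat by (intro exI[of _ 0]) (auto intro!: card_eq_0_iff[THEN iffD2])
  have "fps_nth (bigraded_hilbert_series quotient_scalars (cube_quotient :: 'd lattice_algebra set ring) quotient_part) r
      = Abs_fls ?N"
    by (simp add: bigraded_hilbert_series_def dim_quotient_part card_descent_index)
  also have "\<dots> = fps_nth (refined_eulerian CARD('d) fps_X (fps_const fls_X)) r"
  proof (rule fls_eqI)
    fix k
    have "fls_nth (Abs_fls ?N) k = ?N k" by (rule nth_Abs_fls[OF bdd])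
    also have "\<dots> = (\<Sum>\<sigma>\<in>?P. fls_nth (if desc CARD('d) \<sigma> = r then fls_X ^ maj CARD('d) \<sigma> else 0 :: int fls) k)"
      unfolding N by (intro sum.cong refl) auto
    also have "\<dots> = fls_nth (fps_nth (refined_eulerian CARD('d) fps_X (fps_const fls_X)) r) k"
      unfolding refined_eulerian_nth by (simp add: fls_nth_sum)
    finally show "fls_nth (Abs_fls ?N) k = fls_nth (fps_nth (refined_eulerian CARD('d) fps_X (fps_const fls_X)) r) k" .
  qed
  finally show "fps_nth (bigraded_hilbert_series quotient_scalars (cube_quotient :: 'd lattice_algebra set ring) quotient_part) r
      = fps_nth (refined_eulerian CARD('d) fps_X (fps_const fls_X)) r" .
qed

theorem proposition2p7:
  shows "(\<forall>k \<le> CARD('d). y_elem k \<in> bidegree_part (hypercube :: (real^'d) set) sym_weights (1, int k)) \<and>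
    regular_sequence cube_ring (y_list :: 'd lattice_algebra list) \<and>
    ring.finite_dimension (cube_quotient :: 'd lattice_algebra set ring) quotient_scalars
      (carrier cube_quotient) \<and>
    is_bigrading quotient_scalars (cube_quotient :: 'd lattice_algebra set ring) quotient_part \<and>
    bigraded_hilbert_series quotient_scalars (cube_quotient :: 'd lattice_algebra set ring) quotient_part
      = refined_eulerian CARD('d) fps_X (fps_const fls_X)"
  using y_elem_bidegree[where 'd = 'd] regular_sequence_y_list quotient_dimension
    is_bigrading_quotient hilbert_series_quotient
  by blast

end
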